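(* Let $T>0$ and let $a\colon\mathbb{R}\to\mathbb{R}$ be a locally integrable $T$-periodic function such that $\int_0^T a(t)\,dt<0$ and such that there exist $m\ge1$ intervals $I_1^+,\dots,I_m^+$, closed and pairwise disjoint in the quotient space $\mathbb{R}/T\mathbb{Z}$, with $a(t)\ge0$ for a.e. $t\in I_i^+$ and $a\not\equiv0$ on $I_i^+$ for $i=1,\dots,m$, and $a(t)\le0$ for a.e. $t\in(\mathbb{R}/T\mathbb{Z})\setminus\bigcup_{i=1}^m I_i^+$. Assume further that $a\not\equiv0$ in any interval of $\mathbb{R}$. Let $g\colon[0,+\infty)\to[0,+\infty)$ be a continuous function with $g(0)=0$, $g(u)>0$ for $u>0$, and $\limsup_{u\to0^+}g(u)/u<+\infty$. Suppose that at least one of the following holds: (1) $\lim_{u\to+\infty,\ \omega\to1}g(\omega u)/g(u)=1$; (2) there exists $\varepsilon>0$ such that $g\in\mathcal{C}^1((1/\varepsilon,+\infty))$ and $\lim_{u\to+\infty}g'(u)/g(u)=0$. Let $\rho^*,\lambda^*$ be as described in the context, and let $\{u_{\ell,\lambda}(t)\}_{\lambda>\lambda^*}$ be a family of positive $T$-periodic solutions to $$\left(\frac{u'}{\sqrt{1-(u')^2}}\right)'+\lambda a(t)g(u)=0$$ with $\|u_{\ell,\lambda}\|_\infty>\rho^*$. Then there exists a (not identically zero) Lipschitz continuous and $T$-periodic function $u_\infty(t)$, with $$u_\infty'(t)\in\{-1,0,1\}\quad\text{for a.e. }t\in\mathbb{R},$$ such that, up to subsequences (that is, along some sequence $\lambda_n\to+\infty$),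 $u_{\ell,\lambda}\to u_\infty$ in the strong topology of $W^{1,p}_T$, for any $p\in[1,+\infty)$, as $\lambda\to+\infty$.
   Context: Set $\varphi(\xi)=\xi/\sqrt{1-\xi^2}$ for $\xi\in(-1,1)$. A solution of $(\varphi(u'))'+\lambda a(t)g(u)=0$ is a continuously differentiable function $u$ (with $|u'|<1$) such that $t\mapsto\varphi(u'(t))$ is locally absolutely continuous and the equation holds for almost every $t$. A $T$-periodic solution is a solution defined on $\mathbb{R}$ with $u(t+T)=u(t)$ for all $t$; it is positive if $u(t)>0$ for all $t\in\mathbb{R}$. $\|\cdot\|_\infty$ is the sup-norm. $W^{1,p}_T$ is the Sobolev space of $T$-periodic functions, with the usual $W^{1,p}(0,T)$ norm. "$a\not\equiv0$ on an interval" means $a$ is not a.e. zero there (intervals being non-degenerate). Limits as $u\to+\infty$ and $\omega\to1$ are joint limits. Constants $\rho^*,\lambda^*$: write $I_i^+=[\sigma_i,\tau_i]$ and $|I_i^+|=\tau_i-\sigma_i$. The number $\rho^*>0$ is fixed so that $\rho^*<|I_i^+|/4$ and $\int_{\sigma_i+2\rho^*}^{\tau_i-2\rho^*}a(t)\,dt>0$ for every $i=1,\dots,m$, and $$\lambda^*=\max_{i=1,\dots,m}\frac{2\varphi(1/2)}{\min\{g(u)\colon u\in[2(\rho^* )^2/|I_i^+|,\rho^*]\}\int_{\sigma_i+2\rho^*}^{\tau_i-2\rho^*}a(t)\,dt}.$$ (With this choice, for every $\lambda>\lambda^*$ there exists at least one positive $T$-periodic solution with sup-norm larger than $\rho^*$.)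 *)

theory Defs
  imports "HOL-Analysis.Analysis"
begin

definition phi :: "real \<Rightarrow> real" where
  "phi \<xi> = \<xi> / sqrt (1 - \<xi>\<^sup>2)"

text \<open>The preimage in the real line of the image of \<open>A\<close> in the quotient by \<open>T\<close>-translations.
  Relations between subsets of the circle are expressed through these preimages.\<close>

definition periodize :: "real \<Rightarrow> real set \<Rightarrow> real set" where
  "periodize T A = {t + of_int k * T | t k. t \<in> A}"

definition locally_integrable :: "(real \<Rightarrow> real) \<Rightarrow> bool" where
  "locally_integrable f \<longleftrightarrow> (\<forall>c d. set_integrable lebesgue {c..d} f)"

text \<open>The conditional supremum is meaningful only for bounded \<open>u\<close>; it is applied to continuous
  periodic functions.\<close>

definition sup_norm :: "(real \<Rightarrow> real) \<Rightarrow> real" where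
  "sup_norm u = (SUP t. \<bar>u t\<bar>)"

definition absolutely_continuous_on :: "real \<Rightarrow> real \<Rightarrow> (real \<Rightarrow> real) \<Rightarrow> bool" where
  "absolutely_continuous_on c d f \<longleftrightarrow>
    (\<forall>\<epsilon>>0. \<exists>\<delta>>0. \<forall>(n::nat) s e.
       (\<forall>i<n. c \<le> s i \<and> s i \<le> e i \<and> e i \<le> d) \<and>
       disjoint_family_on (\<lambda>i. {s i<..<e i}) {..<n} \<and>
       (\<Sum>i<n. e i - s i) < \<delta>
       \<longrightarrow> (\<Sum>i<n. \<bar>f (e i) - f (s i)\<bar>) < \<epsilon>)"

definition locally_absolutely_continuous :: "(real \<Rightarrow> real) \<Rightarrow> bool" where
  "locally_absolutely_continuous f \<longleftrightarrow> (\<forall>c d. absolutely_continuous_on c d f)"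

definition is_solution :: "real \<Rightarrow> (real \<Rightarrow> real) \<Rightarrow> (real \<Rightarrow> real) \<Rightarrow> (real \<Rightarrow> real) \<Rightarrow> bool" where
  "is_solution lam a g u \<longleftrightarrow>
     (\<forall>t. u field_differentiable at t) \<and> continuous_on UNIV (deriv u) \<and>
     (\<forall>t. \<bar>deriv u t\<bar> < 1) \<and>
     locally_absolutely_continuous (\<lambda>t. phi (deriv u t)) \<and>
     (AE t in lebesgue.
        (\<lambda>s. phi (deriv u s)) field_differentiable at t \<and>
        deriv (\<lambda>s. phi (deriv u s)) t + lam * a t * g (u t) = 0)"

text \<open>Positivity of \<open>u\<close> ensures that \<open>g\<close> is only evaluated on its actual domain,
  the nonnegative half-line.\<close>

definition positive_periodic_solution ::
    "real \<Rightarrow> real \<Rightarrow> (real \<Rightarrow> real) \<Rightarrow> (real \<Rightarrow> real) \<Rightarrow> (real \<Rightarrow> real) \<Rightarrow> bool" where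
  "positive_periodic_solution T lam a g u \<longleftrightarrow>
     is_solution lam a g u \<and> periodic_fun_simple u T \<and> (\<forall>t. u t > 0)"

text \<open>The infimum below is a minimum, since \<open>g\<close> is continuous on the compact interval.\<close>

definition lambda_star ::
    "nat \<Rightarrow> (nat \<Rightarrow> real) \<Rightarrow> (nat \<Rightarrow> real) \<Rightarrow> (real \<Rightarrow> real) \<Rightarrow> (real \<Rightarrow> real) \<Rightarrow> real \<Rightarrow> real" where
  "lambda_star m \<sigma> \<tau> a g \<rho> =
     Max ((\<lambda>i. 2 * phi (1/2) /
            ((INF x\<in>{2 * \<rho>\<^sup>2 / (\<tau> i - \<sigma> i)..\<rho>}. g x) *
             (LINT t:{\<sigma> i + 2*\<rho>..\<tau> i - 2*\<rho>}|lebesgue. a t))) ` {1..m})"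

definition Lp :: "real \<Rightarrow> real \<Rightarrow> (real \<Rightarrow> real) set" where
  "Lp T p = {f. set_borel_measurable lebesgue {0..T} f \<and>
                set_integrable lebesgue {0..T} (\<lambda>t. \<bar>f t\<bar> powr p)}"

text \<open>Weak derivatives are tested against smooth \<open>T\<close>-periodic functions, as in Mawhin and Willem,
  Critical Point Theory and Hamiltonian Systems. A jump of the periodic function \<open>u\<close> at the
  endpoints of the period is thereby excluded, as it is with compactly supported test functions on
  the whole line.\<close>

definition periodic_test_function :: "real \<Rightarrow> (real \<Rightarrow> real) \<Rightarrow> bool" where
  "periodic_test_function T \<psi> \<longleftrightarrow>
     (\<forall>k t. (deriv ^^ k) \<psi> field_differentiable at t) \<and> periodic_fun_simple \<psi> T"

definition weak_derivative :: "real \<Rightarrow> (real \<Rightarrow> real) \<Rightarrow> (real \<Rightarrow> real) \<Rightarrow> bool" where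
  "weak_derivative T u v \<longleftrightarrow>
     set_integrable lebesgue {0..T} u \<and> set_integrable lebesgue {0..T} v \<and>
     (\<forall>\<psi>. periodic_test_function T \<psi> \<longrightarrow>
        (LINT t:{0..T}|lebesgue. u t * deriv \<psi> t) = - (LINT t:{0..T}|lebesgue. v t * \<psi> t))"

definition W1p :: "real \<Rightarrow> real \<Rightarrow> (real \<Rightarrow> real) set" where
  "W1p T p = {u. periodic_fun_simple u T \<and> u \<in> Lp T p \<and> (\<exists>v \<in> Lp T p. weak_derivative T u v)}"

text \<open>Weak derivatives are unique up to null sets of \<open>[0,T]\<close>, so the choice is immaterial for
  members of \<open>W1p\<close>.\<close>

definition W1p_norm :: "real \<Rightarrow> real \<Rightarrow> (real \<Rightarrow> real) \<Rightarrow> real" where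
  "W1p_norm T p u =
     (let v = (SOME v. weak_derivative T u v) in
      ((LINT t:{0..T}|lebesgue. \<bar>u t\<bar> powr p) + (LINT t:{0..T}|lebesgue. \<bar>v t\<bar> powr p)) powr (1/p))"

definition tendsto_W1p ::
    "real \<Rightarrow> real \<Rightarrow> (nat \<Rightarrow> real \<Rightarrow> real) \<Rightarrow> (real \<Rightarrow> real) \<Rightarrow> bool" where
  "tendsto_W1p T p f h \<longleftrightarrow>
     (\<forall>n. f n \<in> W1p T p) \<and> h \<in> W1p T p \<and> (\<lambda>n. W1p_norm T p (\<lambda>t. f n t - h t)) \<longlonglongrightarrow> 0"

end

theory Submission
  imports Defs "HOL-Complex_Analysis.Complex_Analysis"
begin

text \<open>
  Write \<open>w = phi u'\<close>, so that the equation says \<open>w' = - lam a g(u)\<close> almost everywhere. The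
  absolute continuity of \<open>w\<close> turns this into
  \<open>w(c) - w(d) = lam * integral over [c,d] of a g(u)\<close>, and the whole proof rests on this identity.

  Over a full period the left-hand side vanishes, so \<open>a g(u)\<close> has mean zero. If the maximum \<open>M\<close> of
  \<open>u\<close> were very large, then \<open>u\<close>, which is 1-Lipschitz, would stay within \<open>T\<close> of \<open>M\<close>, and either
  alternative for \<open>g\<close> would force \<open>g(u(t)) / g(M)\<close> to be uniformly close to 1; the mean of \<open>a\<close> would
  then be almost zero, whereas it is negative. Hence all positive periodic solutions obey one
  bound, for all \<open>lam > 0\<close> (\<open>positive_periodic_solutions_bounded\<close>). By Arzela--Ascoli, a sequence
  with \<open>lam\<close> tending to infinity converges uniformly to a 1-Lipschitz periodic function \<open>U\<close>, which is
  not identically zero because the solutions have sup-norm above \<open>\<rho>\<close>.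

  Away from a countable set, every point has a neighbourhood on which \<open>a\<close> has one sign
  (\<open>weight_locally_signed\<close>). There \<open>w\<close> is monotone, hence so is \<open>u'\<close>: the solutions are all concave
  or all convex. For such functions, pointwise convergence implies convergence of the
  derivatives, except at countably many points (\<open>convergence_of_monotone_derivatives\<close>). At a point
  where \<open>U = 0\<close> the limit derivative is 0, since \<open>U\<close> has a minimum there. Finally, consider points
  \<open>c < d\<close> with \<open>U > 0\<close> on \<open>[c,d]\<close> at which the limit derivatives lie strictly between -1 and 1. Then
  \<open>w(c) - w(d)\<close> stays bounded along the sequence, whereas the right-hand side of the identity grows
  like \<open>lam\<close>, because \<open>a\<close> does not vanish identically on \<open>[c,d]\<close> and \<open>g(u)\<close> is bounded below
  there. Such points are therefore isolated, and the limit derivative is -1, 0 or 1 outside a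
  countable set (\<open>limit_derivative_on_signed_interval\<close>).

  Since all the derivatives are bounded by 1, almost everywhere convergence of derivatives gives
  convergence in \<open>W1p\<close> by dominated convergence (\<open>tendsto_W1p_bounded_convergence\<close>). The norm is
  evaluated at an arbitrarily chosen weak derivative, which makes it necessary to know that
  periodic test functions determine an integrable function up to null sets
  (\<open>weak_derivative_unique\<close>).
\<close>

section \<open>The fundamental theorem of calculus for absolutely continuous functions\<close>

text \<open>The tagged intervals of a division carry no natural enumeration, so absolute continuity is
  restated for families over an arbitrary finite index set.\<close>

lemma absolutely_continuous_on_finite_family:
  assumes "absolutely_continuous_on c d f" and "\<epsilon> > 0"
  shows "\<exists>\<delta>>0. \<forall>(I :: 'i set) s e. finite I \<and> (\<forall>i\<in>I. c \<le> s i \<and> s i \<le> e i \<and> e i \<le> d) \<and>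
        disjoint_family_on (\<lambda>i. {s i<..<e i}) I \<and> (\<Sum>i\<in>I. e i - s i) < \<delta>
      \<longrightarrow> (\<Sum>i\<in>I. \<bar>f (e i) - f (s i)\<bar>) < \<epsilon>"
proof -
  obtain \<delta> where \<delta>: "\<delta> > 0" and small: "\<And>(n::nat) s e.
       (\<forall>i<n. c \<le> s i \<and> s i \<le> e i \<and> e i \<le> d) \<and>
       disjoint_family_on (\<lambda>i. {s i<..<e i}) {..<n} \<and> (\<Sum>i<n. e i - s i) < \<delta>
       \<Longrightarrow> (\<Sum>i<n. \<bar>f (e i) - f (s i)\<bar>) < \<epsilon>"
    using assms unfolding absolutely_continuous_on_def by meson
  show ?thesis
  proof (intro exI[of _ \<delta>] conjI allI impI \<delta>, elim conjE)
    fix I :: "'i set" and s e :: "'i \<Rightarrow> real"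
    assume I: "finite I" "\<forall>i\<in>I. c \<le> s i \<and> s i \<le> e i \<and> e i \<le> d"
      "disjoint_family_on (\<lambda>i. {s i<..<e i}) I" "(\<Sum>i\<in>I. e i - s i) < \<delta>"
    obtain h where h: "bij_betw h {..<card I} I"
      using ex_bij_betw_nat_finite[OF I(1)] by (auto simp: atLeast0LessThan)
    have mem: "h k \<in> I" if "k < card I" for k
      using bij_betwE[OF h] that by auto
    have "(\<Sum>k<card I. \<bar>f (e (h k)) - f (s (h k))\<bar>) < \<epsilon>"
    proof (rule small, intro conjI)
      show "\<forall>i<card I. c \<le> s (h i) \<and> s (h i) \<le> e (h i) \<and> e (h i) \<le> d"
        using mem I(2) by blast
      show "disjoint_family_on (\<lambda>i. {s (h i)<..<e (h i)}) {..<card I}"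
        using I(3) bij_betw_imp_inj_on[OF h] mem
        unfolding disjoint_family_on_def inj_on_def by (metis lessThan_iff)
      show "(\<Sum>k<card I. e (h k) - s (h k)) < \<delta>"
        using I(4) sum.reindex_bij_betw[OF h, of "\<lambda>i. e i - s i"] by simp
    qed
    then show "(\<Sum>i\<in>I. \<bar>f (e i) - f (s i)\<bar>) < \<epsilon>"
      using sum.reindex_bij_betw[OF h, of "\<lambda>i. \<bar>f (e i) - f (s i)\<bar>"] by simp
  qed
qed

text \<open>The gauge integral makes this elementary. At a point of differentiability the gauge is the one of
  the usual fundamental theorem. The exceptional null set is covered by an open set of measure less
  than \<open>\<delta>\<close>, and the gauge at an exceptional point keeps its interval inside that open set; the
  increments of \<open>f\<close> over those intervals are then negligible by absolute continuity. The value of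
  the integrand at exceptional points is reset to 0, so that they contribute nothing else.\<close>

lemma fundamental_theorem_of_calculus_absolutely_continuous:
  fixes f h :: "real \<Rightarrow> real"
  assumes cd: "c \<le> d" and ac: "absolutely_continuous_on c d f"
    and deriv: "AE t in lebesgue. (f has_field_derivative h t) (at t)"
  shows "(h has_integral (f d - f c)) {c..d}"
proof -
  obtain N where N: "N \<in> null_sets lebesgue"
    and dN: "\<And>t. t \<notin> N \<Longrightarrow> (f has_field_derivative h t) (at t)"
    using AE_E3[OF deriv] by auto
  have negN: "negligible N"
    using N by (simp add: negligible_iff_null_sets)
  define h0 where "h0 x = (if x \<in> N then 0 else h x)" for x
  have "(h0 has_integral (f d - f c)) {c..d}"
    unfolding has_integral_real
  proof (intro allI impI)
    fix \<epsilon> :: real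
    assume \<epsilon>: "\<epsilon> > 0"
    obtain \<delta> where \<delta>: "\<delta> > 0" and small:
      "\<forall>(I :: (real \<times> real set) set) s e. finite I \<and> (\<forall>i\<in>I. c \<le> s i \<and> s i \<le> e i \<and> e i \<le> d) \<and>
        disjoint_family_on (\<lambda>i. {s i<..<e i}) I \<and> (\<Sum>i\<in>I. e i - s i) < \<delta>
      \<longrightarrow> (\<Sum>i\<in>I. \<bar>f (e i) - f (s i)\<bar>) < \<epsilon> / 2"
      using absolutely_continuous_on_finite_family[OF ac half_gt_zero[OF \<epsilon>]] by (elim exE conjE)
    obtain U where U: "open U" "N \<subseteq> U" "U - N \<in> lmeasurable" "emeasure lebesgue (U - N) < ennreal \<delta>"
      using sets_lebesgue_outer_open[of N \<delta>] N \<delta> by blast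
    have Uset: "U \<in> sets lebesgue"
      using U(1) by auto
    have eU: "emeasure lebesgue U < ennreal \<delta>"
      using U(4) emeasure_Diff_null_set[OF N Uset] by simp
    \<comment> \<open>The summand 2 in the denominator keeps \<open>\<eta>\<close> meaningful when \<open>c = d\<close>.\<close>
    define \<eta> where "\<eta> = \<epsilon> / (2 * (d - c) + 2)"
    have \<eta>: "\<eta> > 0" "\<eta> * (d - c) < \<epsilon> / 2"
      using \<epsilon> cd by (auto simp: \<eta>_def field_simps)
    have "\<exists>r>0. (x \<in> N \<longrightarrow> ball x r \<subseteq> U) \<and>
        (x \<notin> N \<longrightarrow> (\<forall>y. \<bar>y - x\<bar> < r \<longrightarrow> \<bar>f y - f x - (y - x) * h x\<bar> \<le> \<eta> * \<bar>y - x\<bar>))" for x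
    proof (cases "x \<in> N")
      case True
      then show ?thesis
        using U(1,2) by (metis openE subsetD)
    next
      case False
      have "(f has_derivative (*) (h x)) (at x)"
        using dN[OF False] by (simp add: has_field_derivative_def)
      then show ?thesis
        using False \<eta>(1) unfolding has_derivative_at_alt by (auto simp: mult.commute)
    qed
    then obtain r where r: "\<And>x. r x > 0" "\<And>x. x \<in> N \<Longrightarrow> ball x (r x) \<subseteq> U"
      "\<And>x y. x \<notin> N \<Longrightarrow> \<bar>y - x\<bar> < r x \<Longrightarrow> \<bar>f y - f x - (y - x) * h x\<bar> \<le> \<eta> * \<bar>y - x\<bar>"
      by metis
    show "\<exists>\<gamma>. gauge \<gamma> \<and> (\<forall>p. p tagged_division_of {c..d} \<and> \<gamma> fine p \<longrightarrow>
        norm ((\<Sum>(x, K)\<in>p. measure lborel K *\<^sub>R h0 x) - (f d - f c)) < \<epsilon>)"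
    proof (intro exI conjI allI impI)
      show "gauge (\<lambda>x. ball x (r x))"
        using r(1) by (simp add: gauge_ball_dependent)
    next
      fix p
      assume p: "p tagged_division_of {c..d} \<and> (\<lambda>x. ball x (r x)) fine p"
      have fin: "finite p"
        using p by blast
      have K: "\<exists>s e. K = {s..e} \<and> s \<le> x \<and> x \<le> e \<and> c \<le> s \<and> e \<le> d" if xK: "(x, K) \<in> p" for x K
      proof -
        obtain s e where se: "K = cbox s e"
          using tagged_division_ofD(4)[OF conjunct1[OF p] xK] by blast
        have "x \<in> K" "K \<subseteq> {c..d}"
          using tagged_division_ofD(2,3)[OF conjunct1[OF p] xK] by auto
        then show ?thesis
          using se by (intro exI[of _ s] exI[of _ e]) auto
      qed
      have sub: "K \<subseteq> ball x (r x)" if "(x, K) \<in> p" for x K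
        using p that by (auto simp: fine_def)
      let ?s = "\<lambda>z. Inf (snd z) :: real" and ?e = "\<lambda>z. Sup (snd z) :: real"
      have tot: "f d - f c = (\<Sum>(x, K)\<in>p. f (Sup K) - f (Inf K))"
        and len: "d - c = (\<Sum>(x, K)\<in>p. Sup K - Inf K)"
        using additive_tagged_division_1[OF cd, of p f] additive_tagged_division_1[OF cd, of p "\<lambda>x. x"] p
        by auto
      \<comment> \<open>The part of the division that is tagged by exceptional points.\<close>
      define q where "q = {z \<in> p. fst z \<in> N}"
      have disj: "disjoint_family_on (\<lambda>i. {?s i<..<?e i}) q"
      proof (unfold disjoint_family_on_def, intro ballI impI)
        fix z z'
        assume z: "z \<in> q" "z' \<in> q" "z \<noteq> z'"
        obtain x K x' K' where xK: "z = (x, K)" "z' = (x', K')"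
          by (metis surj_pair)
        have "interior K \<inter> interior K' = {}"
          using tagged_division_ofD(5)[of p "{c..d}" x K x' K'] p z xK by (auto simp: q_def)
        then show "{?s z<..<?e z} \<inter> {?s z'<..<?e z'} = {}"
          using K[of x K] K[of x' K'] z xK by (auto simp: q_def interior_atLeastAtMost_real)
      qed
      have finq: "finite q"
        using fin by (simp add: q_def)
      have se: "c \<le> ?s i \<and> ?s i \<le> ?e i \<and> ?e i \<le> d" if "i \<in> q" for i
        using K[of "fst i" "snd i"] that by (auto simp: q_def split_beta)
      have small_q: "(\<Sum>i\<in>q. ?e i - ?s i) < \<delta>"
      proof -
        have sets: "{?s i<..<?e i} \<in> sets lebesgue" for i
          by auto
        have "ennreal (\<Sum>i\<in>q. ?e i - ?s i) = (\<Sum>i\<in>q. ennreal (?e i - ?s i))"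
          using se by (subst sum_ennreal) (auto)
        also have "\<dots> = (\<Sum>i\<in>q. emeasure lebesgue {?s i<..<?e i})"
          using se by (intro sum.cong) auto
        also have "\<dots> = emeasure lebesgue (\<Union>i\<in>q. {?s i<..<?e i})"
          by (rule sum_emeasure) (use disj finq in auto)
        also have "\<dots> \<le> emeasure lebesgue U"
        proof (rule emeasure_mono[OF _ Uset], rule subsetI, elim UN_E)
          fix y z
          assume y: "z \<in> q" "y \<in> {?s z<..<?e z}"
          obtain x K where z: "z = (x, K)"
            by fastforce
          then have "y \<in> K" "(x, K) \<in> p" "x \<in> N"
            using K[of x K] y by (auto simp: q_def)
          then show "y \<in> U"
            using sub[of x K] r(2)[of x] by blast
        qed
        finally have "ennreal (\<Sum>i\<in>q. ?e i - ?s i) < ennreal \<delta>"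
          using eU by (rule le_less_trans)
        moreover have "0 \<le> (\<Sum>i\<in>q. ?e i - ?s i)"
          by (rule sum_nonneg) (use se in force)
        ultimately show ?thesis
          by (metis ennreal_less_iff)
      qed
      have AC: "(\<Sum>i\<in>q. \<bar>f (?e i) - f (?s i)\<bar>) < \<epsilon> / 2"
        by (rule small[rule_format]) (use finq se disj small_q in blast)
      have term_le: "\<bar>measure lborel K * h0 x - (f (Sup K) - f (Inf K))\<bar>
            \<le> \<eta> * (Sup K - Inf K) + (if (x, K) \<in> q then \<bar>f (Sup K) - f (Inf K)\<bar> else 0)"
        if xK: "(x, K) \<in> p" for x K
      proof -
        obtain s e where seK: "K = {s..e}" "s \<le> x" "x \<le> e"
          using K[OF xK] by blast
        show ?thesis
        proof (cases "x \<in> N")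
          case True
          have "0 \<le> \<eta> * (e - s)"
            using seK \<eta>(1) by simp
          then show ?thesis
            using True xK seK by (simp add: q_def h0_def abs_minus_commute)
        next
          case False
          have "\<bar>s - x\<bar> < r x" "\<bar>e - x\<bar> < r x"
            using subsetD[OF sub[OF xK], of s] subsetD[OF sub[OF xK], of e] seK
            by (auto simp: dist_real_def abs_minus_commute)
          then have "\<bar>f s - f x - (s - x) * h x\<bar> \<le> \<eta> * \<bar>s - x\<bar>" "\<bar>f e - f x - (e - x) * h x\<bar> \<le> \<eta> * \<bar>e - x\<bar>"
            using r(3)[OF False] by blast+
          moreover have "\<eta> * \<bar>s - x\<bar> + \<eta> * \<bar>e - x\<bar> = \<eta> * (e - s)"
            using seK by (simp add: algebra_simps)
          moreover have "(e - s) * h x - (f e - f s)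
              = (f s - f x - (s - x) * h x) - (f e - f x - (e - x) * h x)"
            by (simp add: algebra_simps)
          ultimately have "\<bar>(e - s) * h x - (f e - f s)\<bar> \<le> \<eta> * (e - s)"
            by linarith
          then show ?thesis
            using False seK by (simp add: q_def h0_def)
        qed
      qed
      have "norm ((\<Sum>(x, K)\<in>p. measure lborel K *\<^sub>R h0 x) - (f d - f c))
          = \<bar>\<Sum>(x, K)\<in>p. measure lborel K * h0 x - (f (Sup K) - f (Inf K))\<bar>"
        unfolding tot by (simp add: sum_subtractf split_beta)
      also have "\<dots> \<le> (\<Sum>(x, K)\<in>p. \<bar>measure lborel K * h0 x - (f (Sup K) - f (Inf K))\<bar>)"
        by (simp add: split_beta)
      also have "\<dots> \<le> (\<Sum>(x, K)\<in>p. \<eta> * (Sup K - Inf K) + (if (x, K) \<in> q then \<bar>f (Sup K) - f (Inf K)\<bar> else 0))"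
        by (rule sum_mono) (use term_le in auto)
      also have "\<dots> = \<eta> * (d - c) + (\<Sum>z\<in>p. if z \<in> q then \<bar>f (?e z) - f (?s z)\<bar> else 0)"
        unfolding len by (simp add: sum.distrib split_beta sum_distrib_left)
      also have "(\<Sum>z\<in>p. if z \<in> q then \<bar>f (?e z) - f (?s z)\<bar> else 0) = (\<Sum>z\<in>q. \<bar>f (?e z) - f (?s z)\<bar>)"
        using fin by (subst sum.inter_restrict[symmetric]) (auto simp: q_def intro!: sum.cong)
      finally show "norm ((\<Sum>(x, K)\<in>p. measure lborel K *\<^sub>R h0 x) - (f d - f c)) < \<epsilon>"
        using AC \<eta>(2) by linarith
    qed
  qed
  then show ?thesis
    by (rule has_integral_spike[OF negN, rotated]) (auto simp: h0_def)
qed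

section \<open>Solutions and their a priori bound\<close>

lemma set_integrable_mult_continuous:
  fixes a h :: "real \<Rightarrow> real"
  assumes "set_integrable lebesgue {c..d} a" and h: "continuous_on {c..d} h"
  shows "set_integrable lebesgue {c..d} (\<lambda>t. a t * h t)"
proof -
  have "bounded (h ` {c..d})"
    by (intro compact_imp_bounded compact_continuous_image h) auto
  moreover have "h \<in> borel_measurable (lebesgue_on {c..d})"
    by (rule continuous_imp_measurable_on_sets_lebesgue[OF h]) auto
  ultimately show ?thesis
    using absolutely_integrable_bounded_measurable_product_real[of h "{c..d}" a] assms(1)
    by (simp add: mult.commute)
qed

lemma solution_has_field_derivative:
  "is_solution lam a g u \<Longrightarrow> (u has_field_derivative deriv u t) (at t)"
  by (simp add: is_solution_def field_differentiable_derivI)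

lemma solution_continuous_on: "is_solution lam a g u \<Longrightarrow> continuous_on S u"
  by (metis DERIV_isCont continuous_at_imp_continuous_on solution_has_field_derivative)

lemma solution_nonexpansive:
  assumes "is_solution lam a g u"
  shows "\<bar>u s - u t\<bar> \<le> \<bar>s - t\<bar>"
  using field_differentiable_bound[of UNIV u "deriv u" 1 s t] solution_has_field_derivative[OF assms] assms
  by (auto simp: is_solution_def less_imp_le)

text \<open>The integrated equation. The positivity of \<open>u\<close> keeps \<open>u t\<close> in the half-line on which \<open>g\<close> is
  continuous.\<close>

lemma solution_integral_identity:
  assumes a: "locally_integrable a" and g: "continuous_on {0..} g"
    and sol: "is_solution lam a g u" and pos: "\<And>t. u t > 0" and "c \<le> d"
  shows "set_integrable lebesgue {c..d} (\<lambda>t. a t * g (u t))"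
    and "phi (deriv u d) - phi (deriv u c) = - lam * (LINT t:{c..d}|lebesgue. a t * g (u t))"
proof -
  have "continuous_on {c..d} u"
    by (rule solution_continuous_on[OF sol])
  then have "continuous_on {c..d} (\<lambda>t. g (u t))"
    by (rule continuous_on_compose2[OF g]) (use pos in \<open>auto simp: less_imp_le\<close>)
  then show int: "set_integrable lebesgue {c..d} (\<lambda>t. a t * g (u t))"
    using a by (intro set_integrable_mult_continuous) (auto simp: locally_integrable_def)
  have ac: "absolutely_continuous_on c d (\<lambda>t. phi (deriv u t))"
    using sol by (simp add: is_solution_def locally_absolutely_continuous_def)
  have "AE t in lebesgue. (\<lambda>s. phi (deriv u s)) field_differentiable at t \<and>
        deriv (\<lambda>s. phi (deriv u s)) t + lam * a t * g (u t) = 0"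
    using sol by (simp add: is_solution_def)
  then have "AE t in lebesgue. ((\<lambda>s. phi (deriv u s)) has_field_derivative - lam * (a t * g (u t))) (at t)"
  proof eventually_elim
    case (elim t)
    then have "deriv (\<lambda>s. phi (deriv u s)) t = - lam * (a t * g (u t))"
      by (simp add: algebra_simps)
    with field_differentiable_derivI[OF conjunct1[OF elim]] show ?case
      by simp
  qed
  from fundamental_theorem_of_calculus_absolutely_continuous[OF \<open>c \<le> d\<close> ac this]
  have "((\<lambda>t. - lam * (a t * g (u t))) has_integral (phi (deriv u d) - phi (deriv u c))) {c..d}" .
  moreover have "((\<lambda>t. - lam * (a t * g (u t))) has_integral (- lam * (LINT t:{c..d}|lebesgue. a t * g (u t)))) {c..d}"
    using has_integral_mult_right[OF has_integral_set_lebesgue[OF int], of "- lam"] by simp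
  ultimately show "phi (deriv u d) - phi (deriv u c) = - lam * (LINT t:{c..d}|lebesgue. a t * g (u t))"
    by (rule has_integral_unique)
qed

text \<open>What both alternatives for \<open>g\<close> have in common: on a window of fixed length \<open>T\<close> below a large \<open>x\<close>,
  the function is nearly constant relative to \<open>g x\<close>. Under the first alternative this holds because
  \<open>y = \<omega> x\<close> with \<open>\<omega>\<close> within \<open>T / x\<close> of 1. Under the second, the logarithm of \<open>g\<close> has
  derivative \<open>g' / g\<close>, which tends to 0, and the mean value theorem applies to it.\<close>

lemma ratio_tends_to_one_on_windows:
  fixes g :: "real \<Rightarrow> real"
  assumes T: "T > 0" and g_pos: "\<And>x. x > 0 \<Longrightarrow> g x > 0" and e: "e > 0"
    and g_infty:
      "((\<lambda>(x, \<omega>). g (\<omega> * x) / g x) \<longlongrightarrow> 1) (at_top \<times>\<^sub>F at 1)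
       \<or> (\<exists>\<epsilon>>0. (\<forall>x>1/\<epsilon>. g field_differentiable at x) \<and> continuous_on {1/\<epsilon><..} (deriv g) \<and>
                 ((\<lambda>x. deriv g x / g x) \<longlongrightarrow> 0) at_top)"
  obtains X where "X > 0" "\<And>x y. \<lbrakk>x \<ge> X; x - T \<le> y; y \<le> x\<rbrakk> \<Longrightarrow> \<bar>g y / g x - 1\<bar> \<le> e"
using g_infty
proof (elim disjE exE conjE)
  assume "((\<lambda>(x, \<omega>). g (\<omega> * x) / g x) \<longlongrightarrow> 1) (at_top \<times>\<^sub>F at 1)"
  then have "\<forall>\<^sub>F z in at_top \<times>\<^sub>F at 1. dist ((\<lambda>(x, \<omega>). g (\<omega> * x) / g x) z) 1 < e"
    using e tendstoD by blast
  then obtain P Q where P: "eventually P at_top" and Q: "eventually Q (at (1::real))"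
    and PQ: "\<And>x \<omega>. P x \<Longrightarrow> Q \<omega> \<Longrightarrow> \<bar>g (\<omega> * x) / g x - 1\<bar> < e"
    unfolding eventually_prod_filter by (auto simp: dist_real_def)
  obtain X0 where X0: "\<And>x. x \<ge> X0 \<Longrightarrow> P x"
    using P by (auto simp: eventually_at_top_linorder)
  obtain \<delta> where \<delta>: "\<delta> > 0" "\<And>\<omega>. \<omega> \<noteq> 1 \<Longrightarrow> \<bar>\<omega> - 1\<bar> < \<delta> \<Longrightarrow> Q \<omega>"
    using Q by (auto simp: eventually_at dist_real_def)
  show thesis
  proof (rule that[of "max X0 (T / \<delta> + 1)"])
    show "max X0 (T / \<delta> + 1) > 0"
      using T \<delta>(1) by (simp add: less_max_iff_disj add_pos_pos)
    fix x y
    assume xy: "max X0 (T / \<delta> + 1) \<le> x" "x - T \<le> y" "y \<le> x"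
    then have "x > T / \<delta>"
      by simp
    moreover have "T / \<delta> > 0"
      using T \<delta>(1) by simp
    ultimately have x: "x > 0" "x > T / \<delta>"
      by linarith+
    show "\<bar>g y / g x - 1\<bar> \<le> e"
    \<comment> \<open>The filter \<open>at 1\<close> excludes \<open>\<omega> = 1\<close>, so \<open>y = x\<close> is treated apart.\<close>
    proof (cases "y = x")
      case True
      then show ?thesis
        using g_pos[OF x(1)] e by simp
    next
      case False
      have "\<bar>y / x - 1\<bar> = (x - y) / x"
        using x xy by (simp add: field_simps abs_if)
      also have "\<dots> \<le> T / x"
        using x xy by (intro divide_right_mono) auto
      also have "\<dots> < \<delta>"
        using x \<delta>(1) by (simp add: field_simps)
      finally have "Q (y / x)"
        using False x by (intro \<delta>(2)) auto
      then have "\<bar>g (y / x * x) / g x - 1\<bar> < e"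
        using xy by (intro PQ X0) auto
      then show ?thesis
        using x by simp
    qed
  qed
next
  fix \<epsilon> :: real
  assume \<epsilon>: "\<epsilon> > 0" and diff: "\<forall>x>1/\<epsilon>. g field_differentiable at x"
    and lim: "((\<lambda>x. deriv g x / g x) \<longlongrightarrow> 0) at_top"
  \<comment> \<open>Chosen so that a change of at most \<open>\<eta> T\<close> in \<open>ln g\<close> changes \<open>g\<close> by a factor of at most \<open>1 + e\<close>.\<close>
  define \<eta> where "\<eta> = ln (1 + e) / T"
  have \<eta>: "\<eta> > 0"
    using T e by (simp add: \<eta>_def)
  have "\<forall>\<^sub>F x in at_top. \<bar>deriv g x / g x\<bar> < \<eta>"
    using tendstoD[OF lim \<eta>] by (simp add: dist_real_def)
  then obtain X0 where X0: "\<And>x. x \<ge> X0 \<Longrightarrow> \<bar>deriv g x / g x\<bar> < \<eta>"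
    by (auto simp: eventually_at_top_linorder)
  show thesis
  proof (rule that[of "max X0 (1 / \<epsilon> + 1) + T"])
    show "max X0 (1 / \<epsilon> + 1) + T > 0"
      using T \<epsilon> by (intro add_pos_pos) (auto simp: less_max_iff_disj add_pos_pos)
    fix x y
    assume xy: "max X0 (1 / \<epsilon> + 1) + T \<le> x" "x - T \<le> y" "y \<le> x"
    have big: "z \<ge> X0 \<and> z > 1 / \<epsilon> \<and> z > 0" if "z \<ge> y" for z
    proof -
      have "z \<ge> X0 \<and> z > 1 / \<epsilon>"
        using xy that by linarith
      moreover have "1 / \<epsilon> > 0"
        using \<epsilon> by simp
      ultimately show ?thesis
        by linarith
    qed
    have "norm (ln (g y) - ln (g x)) \<le> \<eta> * norm (y - x)"
    proof (rule field_differentiable_bound[of "{y..x}" "\<lambda>z. ln (g z)" "\<lambda>z. deriv g z / g z" \<eta> y x])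
      fix z
      assume "z \<in> {y..x}"
      then have z: "z \<ge> X0" "z > 1 / \<epsilon>" "z > 0"
        using big[of z] by auto
      have "(g has_field_derivative deriv g z) (at z)"
        using diff z by (simp add: field_differentiable_derivI)
      then have "((\<lambda>z. ln (g z)) has_field_derivative deriv g z / g z) (at z)"
        using g_pos[OF z(3)] by (auto intro!: derivative_eq_intros)
      then show "((\<lambda>z. ln (g z)) has_field_derivative deriv g z / g z) (at z within {y..x})"
        by (rule has_field_derivative_at_within)
      show "norm (deriv g z / g z) \<le> \<eta>"
        using X0[OF z(1)] by simp
    qed (use xy in auto)
    also have "\<dots> \<le> \<eta> * T"
      using xy \<eta> by (intro mult_left_mono) auto
    also have "\<dots> = ln (1 + e)"
      using T by (simp add: \<eta>_def)
    finally have le: "\<bar>ln (g y) - ln (g x)\<bar> \<le> ln (1 + e)"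
      by simp
    define r where "r = g y / g x"
    have gp: "g x > 0" "g y > 0"
      using big[of x] big[of y] xy g_pos by auto
    then have r: "r > 0" "\<bar>ln r\<bar> \<le> ln (1 + e)"
      using le by (auto simp: r_def ln_div)
    have "r \<le> 1 + e"
      using ln_le_cancel_iff[of r "1 + e"] r(1) abs_le_D1[OF r(2)] e by linarith
    moreover have "1 / (1 + e) \<le> r"
    proof -
      have "ln (1 / (1 + e)) \<le> ln r"
        using r(2) e by (simp add: ln_div abs_le_iff)
      then show ?thesis
        using r(1) e ln_le_cancel_iff[of "1 / (1 + e)" r] by simp
    qed
    moreover have "1 - e \<le> 1 / (1 + e)"
      using e by (simp add: field_simps)
    ultimately show "\<bar>g y / g x - 1\<bar> \<le> e"
      unfolding r_def by linarith
  qed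
qed

lemma periodic_fun_simple_reduce:
  assumes "periodic_fun_simple f T" and "T > 0"
  shows "f (T * frac (t / T)) = f t" and "T * frac (t / T) \<in> {0..T}"
proof -
  interpret periodic_fun_simple f T
    by fact
  have "T * frac (t / T) + of_int \<lfloor>t / T\<rfloor> * T = t"
    using assms(2) by (simp add: frac_def right_diff_distrib)
  then show "f (T * frac (t / T)) = f t"
    using plus_of_int[of "T * frac (t / T)" "\<lfloor>t / T\<rfloor>"] by simp
  show "T * frac (t / T) \<in> {0..T}"
    using assms(2) frac_ge_0[of "t / T"] frac_lt_1[of "t / T"] by (simp add: less_imp_le)
qed

lemma deriv_periodic:
  fixes u :: "real \<Rightarrow> real"
  assumes "periodic_fun_simple u T" and "\<And>t. (u has_field_derivative u' t) (at t)"
  shows "u' (t + T) = u' t"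
proof -
  have "(\<lambda>t. u (t + T)) = u"
    using periodic_fun_simple.plus_period[OF assms(1)] by auto
  then have "(u has_field_derivative u' (t + T)) (at t)"
    using DERIV_shift[of u "u' (t + T)" t T] assms(2)[of "t + T"] by (simp add: add.commute)
  then show ?thesis
    using assms(2) DERIV_unique by blast
qed

text \<open>The bound is uniform in the parameter because \<open>lam\<close> cancels from the mean-zero identity for
  \<open>a g(u)\<close>. Dividing that identity by \<open>g M\<close>, with \<open>M\<close> the maximum of \<open>u\<close>, gives
  \<open>- A = \<integral> a (g(u) / g M - 1) \<le> e B\<close> as soon as \<open>M \<ge> X\<close>, where \<open>A < 0\<close> is the
  integral of \<open>a\<close> and \<open>B\<close> that of its absolute value; the choice of \<open>e\<close> makes this impossible.\<close>

lemma positive_periodic_solutions_bounded: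
  assumes T: "T > 0"
    and a_locint: "locally_integrable a"
    and a_mean: "(LINT t:{0..T}|lebesgue. a t) < 0"
    and g_cont: "continuous_on {0..} g"
    and g_pos: "\<And>x. x > 0 \<Longrightarrow> g x > 0"
    and g_infty:
      "((\<lambda>(x, \<omega>). g (\<omega> * x) / g x) \<longlongrightarrow> 1) (at_top \<times>\<^sub>F at 1)
       \<or> (\<exists>\<epsilon>>0. (\<forall>x>1/\<epsilon>. g field_differentiable at x) \<and> continuous_on {1/\<epsilon><..} (deriv g) \<and>
                 ((\<lambda>x. deriv g x / g x) \<longlongrightarrow> 0) at_top)"
  obtains K where "\<And>lam u t. lam > 0 \<Longrightarrow> positive_periodic_solution T lam a g u \<Longrightarrow> u t \<le> K"
proof -
  define A where "A = (LINT t:{0..T}|lebesgue. a t)"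
  define B where "B = (LINT t:{0..T}|lebesgue. \<bar>a t\<bar>)"
  have ai: "set_integrable lebesgue {0..T} a"
    using a_locint by (simp add: locally_integrable_def)
  have B: "B \<ge> 0"
    unfolding B_def set_lebesgue_integral_def by (rule integral_nonneg_AE) auto
  define e where "e = - A / (2 * (B + 1))"
  have A: "A < 0"
    using a_mean by (simp add: A_def)
  have "A * B \<le> 0"
    using A B by (simp add: mult_nonpos_nonneg)
  then have e: "e > 0" "e * B < - A"
    using A B by (auto simp: e_def field_simps)
  obtain X where X: "X > 0" "\<And>x y. \<lbrakk>x \<ge> X; x - T \<le> y; y \<le> x\<rbrakk> \<Longrightarrow> \<bar>g y / g x - 1\<bar> \<le> e"
    using ratio_tends_to_one_on_windows[OF T g_pos e(1) g_infty] by blast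
  show thesis
  proof (rule that[of X])
    fix lam u t
    assume lam: "lam > (0::real)" and pps: "positive_periodic_solution T lam a g u"
    then have sol: "is_solution lam a g u" and per: "periodic_fun_simple u T" and pos: "\<And>t. u t > 0"
      by (auto simp: positive_periodic_solution_def)
    have cont: "continuous_on {0..T} u"
      by (rule solution_continuous_on[OF sol])
    obtain t0 where t0: "t0 \<in> {0..T}" "\<And>t. t \<in> {0..T} \<Longrightarrow> u t \<le> u t0"
      using continuous_attains_sup[OF _ _ cont] T by auto
    define M where "M = u t0"
    have "M < X"
    proof (rule ccontr)
      assume "\<not> M < X"
      then have M: "M \<ge> X" "g M > 0"
        using X(1) g_pos by auto
      have close: "\<bar>g (u t) / g M - 1\<bar> \<le> e" if "t \<in> {0..T}" for t
      proof (rule X(2)[OF M(1)])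
        have "\<bar>u t0 - u t\<bar> \<le> \<bar>t0 - t\<bar>"
          by (rule solution_nonexpansive[OF sol])
        then show "M - T \<le> u t"
          using that t0(1) by (auto simp: M_def)
        show "u t \<le> M"
          using t0(2)[OF that] by (simp add: M_def)
      qed
      have int: "set_integrable lebesgue {0..T} (\<lambda>t. a t * g (u t))"
        and id: "phi (deriv u T) - phi (deriv u 0) = - lam * (LINT t:{0..T}|lebesgue. a t * g (u t))"
        using solution_integral_identity[OF a_locint g_cont sol pos, of 0 T] T by auto
      have "deriv u T = deriv u 0"
        using deriv_periodic[OF per solution_has_field_derivative[OF sol], of 0] by simp
      then have zero: "(LINT t:{0..T}|lebesgue. a t * g (u t)) = 0"
        using id lam by simp
      have int': "set_integrable lebesgue {0..T} (\<lambda>t. a t * g (u t) / g M)"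
        using set_integrable_divide[of "g M" lebesgue "{0..T}" "\<lambda>t. a t * g (u t)"] int by auto
      have "(LINT t:{0..T}|lebesgue. a t * g (u t) / g M - a t) = - A"
        using set_integral_diff(2)[OF int' ai] zero by (simp add: A_def set_integral_divide_zero)
      moreover have "(LINT t:{0..T}|lebesgue. a t * g (u t) / g M - a t) \<le> (LINT t:{0..T}|lebesgue. e * \<bar>a t\<bar>)"
      proof (rule set_integral_mono)
        show "set_integrable lebesgue {0..T} (\<lambda>t. a t * g (u t) / g M - a t)"
          using int' ai by (rule set_integral_diff)
        show "set_integrable lebesgue {0..T} (\<lambda>t. e * \<bar>a t\<bar>)"
          using ai by (simp add: set_integrable_abs)
        fix t
        assume t: "t \<in> {0..T}"
        have "a t * g (u t) / g M - a t = a t * (g (u t) / g M - 1)"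
          by (simp add: algebra_simps)
        also have "\<dots> \<le> \<bar>a t\<bar> * \<bar>g (u t) / g M - 1\<bar>"
          by (metis abs_ge_self abs_mult)
        also have "\<dots> \<le> \<bar>a t\<bar> * e"
          using close[OF t] by (intro mult_left_mono) auto
        finally show "a t * g (u t) / g M - a t \<le> e * \<bar>a t\<bar>"
          by (simp add: mult.commute)
      qed
      moreover have "(LINT t:{0..T}|lebesgue. e * \<bar>a t\<bar>) = e * B"
        by (simp add: B_def)
      ultimately show False
        using e(2) by linarith
    qed
    then show "u t \<le> X"
      using periodic_fun_simple_reduce[OF per T, of t] t0(2)[of "T * frac (t / T)"] by (auto simp: M_def)
  qed
qed

section \<open>Convergence of monotone derivatives\<close>

text \<open>A pointwise limit of convex functions has increasing difference quotients. Its right derivative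
  \<open>D\<close>, written as an infimum of slopes, is monotone, and so continuous off a countable set. At a
  point \<open>t\<close> of continuity, both the slopes of \<open>F\<close> at \<open>t\<close> and the derivatives \<open>f' n t\<close> are squeezed
  between values that \<open>D\<close> takes near \<open>t\<close>, so all of them tend to \<open>D t\<close>.\<close>

lemma convergence_of_monotone_derivatives:
  fixes f f' :: "nat \<Rightarrow> real \<Rightarrow> real"
  assumes der: "\<And>n t. t \<in> {p<..<q} \<Longrightarrow> (f n has_field_derivative f' n t) (at t)"
    and mono: "\<And>n. mono_on {p<..<q} (f' n)"
    and bound: "\<And>n t. t \<in> {p<..<q} \<Longrightarrow> \<bar>f' n t\<bar> \<le> B"
    and lim: "\<And>t. t \<in> {p<..<q} \<Longrightarrow> (\<lambda>n. f n t) \<longlonglongrightarrow> F t"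
  shows "\<exists>C. countable C \<and> (\<forall>t\<in>{p<..<q} - C. \<exists>L. (F has_field_derivative L) (at t) \<and> (\<lambda>n. f' n t) \<longlonglongrightarrow> L)"
proof -
  define slope where "slope h c d = (h d - h c) / (d - c)" for h :: "real \<Rightarrow> real" and c d
  have slope_n: "f' n c \<le> slope (f n) c d \<and> slope (f n) c d \<le> f' n d"
    if cd: "p < c" "c < d" "d < q" for n c d
  proof -
    obtain z where z: "c < z" "z < d" "f n d - f n c = (d - c) * f' n z"
      using MVT2[OF cd(2), of "f n" "f' n"] der cd by auto
    then have "slope (f n) c d = f' n z"
      using cd by (simp add: slope_def)
    then show ?thesis
      using mono_onD[OF mono, of c z n] mono_onD[OF mono, of z d n] z cd by auto
  qed
  have slope_lim: "(\<lambda>n. slope (f n) c d) \<longlonglongrightarrow> slope F c d" if "p < c" "c < d" "d < q" for c d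
    unfolding slope_def using that by (intro tendsto_intros lim) auto
  have three: "slope F c t \<le> slope F t d" if "p < c" "c < t" "t < d" "d < q" for c t d
  proof (rule LIMSEQ_le[OF slope_lim slope_lim])
    show "\<exists>N. \<forall>n\<ge>N. slope (f n) c t \<le> slope (f n) t d"
      using slope_n[of c t] slope_n[of t d] that by (meson less_trans order_trans)
  qed (use that in auto)
  have slope_ge: "- B \<le> slope F c d" if "p < c" "c < d" "d < q" for c d
  proof (rule LIMSEQ_le_const[OF slope_lim[OF that]])
    show "\<exists>N. \<forall>n\<ge>N. - B \<le> slope (f n) c d"
    proof (intro exI[of _ 0] allI impI)
      fix n
      show "- B \<le> slope (f n) c d"
        using slope_n[OF that, of n] bound[of c n] that by (simp add: abs_le_iff)
    qed
  qed
  define D where "D t = (INF d\<in>{t<..<q}. slope F t d)" for t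
  have D: "D c \<le> slope F c d" "slope F c d \<le> D d" if cd: "p < c" "c < d" "d < q" for c d
  proof -
    show "D c \<le> slope F c d"
      unfolding D_def
    proof (rule cINF_lower)
      show "bdd_below (slope F c ` {c<..<q})"
        by (rule bdd_belowI[of _ "- B"]) (use slope_ge cd in auto)
    qed (use cd in auto)
    show "slope F c d \<le> D d"
      unfolding D_def by (rule cINF_greatest) (use three cd in auto)
  qed
  have "mono_on {p<..<q} D"
  proof (rule mono_onI)
    fix r s
    assume "r \<in> {p<..<q}" "s \<in> {p<..<q}" "r \<le> s"
    then show "D r \<le> D s"
      using D[of r s] by (cases "r = s") auto
  qed
  then have "countable {t \<in> {p<..<q}. \<not> isCont D t}"
    by (intro mono_on_ctble_discont_open) auto
  moreover have "(F has_field_derivative D t) (at t) \<and> (\<lambda>n. f' n t) \<longlonglongrightarrow> D t"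
    if t: "t \<in> {p<..<q}" and cont: "isCont D t" for t
  proof -
    have near: "\<exists>\<delta>>0. p < t - \<delta> \<and> t + \<delta> < q \<and> (\<forall>s. \<bar>s - t\<bar> \<le> \<delta> \<longrightarrow> \<bar>D s - D t\<bar> < e)" if epos: "e > 0" for e
    proof -
      obtain \<delta> where \<delta>: "\<delta> > 0" "\<And>s. \<bar>s - t\<bar> < \<delta> \<Longrightarrow> \<bar>D s - D t\<bar> < e"
        using cont epos unfolding continuous_at_eps_delta dist_real_def by metis
      define \<delta>' where "\<delta>' = min \<delta> (min (t - p) (q - t)) / 2"
      have "\<delta>' > 0" "\<delta>' < \<delta>" "\<delta>' < t - p" "\<delta>' < q - t"
        using t \<delta>(1) by (auto simp: \<delta>'_def min_def)
      then show ?thesis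
        using \<delta>(2) by (intro exI[of _ \<delta>']) auto
    qed
    have "((\<lambda>y. (F y - F t) / (y - t)) \<longlongrightarrow> D t) (at t)"
    proof (rule tendstoI)
      fix e :: real
      assume "e > 0"
      from near[OF this] obtain \<delta> where \<delta>: "\<delta> > 0" "p < t - \<delta>" "t + \<delta> < q"
        and D\<delta>: "\<And>s. \<bar>s - t\<bar> \<le> \<delta> \<Longrightarrow> \<bar>D s - D t\<bar> < e"
        by blast
      have "dist ((F y - F t) / (y - t)) (D t) < e" if y: "y \<noteq> t" "dist y t < \<delta>" for y
      proof (cases "t < y")
        case True
        then have "D t \<le> slope F t y" "slope F t y \<le> D y"
          using D[of t y] t y \<delta> by (auto simp: dist_real_def)
        then show ?thesis
          using D\<delta>[of y] y by (auto simp: dist_real_def slope_def)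
      next
        case False
        then have "D y \<le> slope F y t" "slope F y t \<le> D t"
          using D[of y t] t y \<delta> by (auto simp: dist_real_def)
        moreover have "slope F y t = (F y - F t) / (y - t)"
          unfolding slope_def by (metis minus_diff_eq minus_divide_divide)
        ultimately show ?thesis
          using D\<delta>[of y] y by (auto simp: dist_real_def)
      qed
      then show "\<forall>\<^sub>F y in at t. dist ((F y - F t) / (y - t)) (D t) < e"
        using \<delta>(1) by (auto simp: eventually_at)
    qed
    moreover have "(\<lambda>n. f' n t) \<longlonglongrightarrow> D t"
    proof (rule tendstoI)
      fix e :: real
      assume "e > 0"
      from near[OF this] obtain \<delta> where \<delta>: "\<delta> > 0" "p < t - \<delta>" "t + \<delta> < q"
        and D\<delta>: "\<And>s. \<bar>s - t\<bar> \<le> \<delta> \<Longrightarrow> \<bar>D s - D t\<bar> < e"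
        by blast
      have "slope F t (t + \<delta>) < D t + e" "D t - e < slope F (t - \<delta>) t"
        using D[of t "t + \<delta>"] D[of "t - \<delta>" t] D\<delta>[of "t + \<delta>"] D\<delta>[of "t - \<delta>"] t \<delta> by auto
      then have "\<forall>\<^sub>F n in sequentially. slope (f n) t (t + \<delta>) < D t + e"
        "\<forall>\<^sub>F n in sequentially. D t - e < slope (f n) (t - \<delta>) t"
        using order_tendstoD(2)[OF slope_lim[of t "t + \<delta>"]] order_tendstoD(1)[OF slope_lim[of "t - \<delta>" t]] t \<delta>
        by auto
      then show "\<forall>\<^sub>F n in sequentially. dist (f' n t) (D t) < e"
      proof eventually_elim
        case (elim n)
        then show ?case
          using slope_n[of t "t + \<delta>" n] slope_n[of "t - \<delta>" t n] t \<delta> by (auto simp: dist_real_def)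
      qed
    qed
    ultimately show ?thesis
      by (simp add: has_field_derivative_iff)
  qed
  ultimately show ?thesis
    by (intro exI[of _ "{t \<in> {p<..<q}. \<not> isCont D t}"]) blast
qed

text \<open>The intervals can be shrunk to have rational endpoints, and there are only countably many of those.\<close>

lemma countable_if_locally_countable:
  fixes S :: "real set"
  assumes "\<And>x. x \<in> S \<Longrightarrow> \<exists>p q. p < x \<and> x < q \<and> countable (S \<inter> {p<..<q})"
  shows "countable S"
proof -
  define I where "I = {(r, s) \<in> \<rat> \<times> \<rat>. countable (S \<inter> {r<..<s})}"
  have "countable I"
    by (rule countable_subset[of _ "\<rat> \<times> \<rat>"]) (auto simp: I_def countable_rat)
  then have "countable (\<Union>(r, s)\<in>I. S \<inter> {r<..<s})"
    by (rule countable_UN) (auto simp: I_def)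
  moreover have "S \<subseteq> (\<Union>(r, s)\<in>I. S \<inter> {r<..<s})"
  proof
    fix x
    assume x: "x \<in> S"
    then obtain p q where pq: "p < x" "x < q" "countable (S \<inter> {p<..<q})"
      using assms by blast
    obtain r s where rs: "r \<in> \<rat>" "p < r" "r < x" "s \<in> \<rat>" "x < s" "s < q"
      using Rats_dense_in_real[OF pq(1)] Rats_dense_in_real[OF pq(2)] by blast
    have "countable (S \<inter> {r<..<s})"
      by (rule countable_subset[OF _ pq(3)]) (use rs in auto)
    then have "(r, s) \<in> I" "x \<in> S \<inter> {r<..<s}"
      using rs x by (auto simp: I_def)
    then show "x \<in> (\<Union>(r, s)\<in>I. S \<inter> {r<..<s})"
      by blast
  qed
  ultimately show ?thesis
    using countable_subset by blast
qed

section \<open>The sign of the weight\<close>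

lemma AE_lebesgue_translate:
  fixes c :: real
  assumes "AE t in lebesgue. P t"
  shows "AE t in lebesgue. P (t - c)"
proof -
  obtain N where N: "N \<in> null_sets lebesgue" "\<And>t. t \<notin> N \<Longrightarrow> P t"
    using AE_E3[OF assms] by auto
  have "negligible ((+) c ` N)"
    using N(1) by (intro negligible_translation) (simp add: negligible_iff_null_sets)
  then show ?thesis
  proof (intro AE_I')
    show "{t \<in> space lebesgue. \<not> P (t - c)} \<subseteq> (+) c ` N"
    proof
      fix t
      assume "t \<in> {t \<in> space lebesgue. \<not> P (t - c)}"
      then have "t - c \<in> N"
        using N(2) by auto
      then show "t \<in> (+) c ` N"
        by (intro image_eqI[of _ _ "t - c"]) auto
    qed
  qed (simp add: negligible_iff_null_sets)
qed

lemma closed_periodize: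
  assumes "compact A"
  shows "closed (periodize T A)"
proof -
  have "closed (\<Union>x\<in>A. \<Union>y\<in>(*\<^sub>R) T ` \<int>. {x + y})"
    by (intro compact_closed_sums assms closed_scaling closed_Ints)
  moreover have "(\<Union>x\<in>A. \<Union>y\<in>(*\<^sub>R) T ` \<int>. {x + y}) = periodize T A"
    unfolding periodize_def by (auto simp: Ints_def mult.commute)
  ultimately show ?thesis
    by simp
qed

lemma countable_periodize:
  assumes "countable A"
  shows "countable (periodize T A)"
proof -
  have "periodize T A = (\<lambda>(t, k). t + of_int k * T) ` (A \<times> UNIV)"
    by (auto simp: periodize_def)
  then show ?thesis
    using assms by simp
qed

text \<open>The excluded points are the translates of the endpoints of the intervals of positivity. Any other point is either
  interior to a translate of such an interval, where periodicity carries over the sign of \<open>a\<close>, or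
  outside all of them, and then it has a neighbourhood outside because their union is closed.\<close>

lemma weight_locally_signed:
  fixes a :: "real \<Rightarrow> real" and \<sigma> \<tau> :: "nat \<Rightarrow> real"
  assumes a_per: "periodic_fun_simple a T"
    and a_pos: "\<And>i. i \<in> {1..m} \<Longrightarrow> AE t in lebesgue. t \<in> {\<sigma> i..\<tau> i} \<longrightarrow> a t \<ge> 0"
    and a_neg: "AE t in lebesgue. t \<notin> (\<Union>i\<in>{1..m}. periodize T {\<sigma> i..\<tau> i}) \<longrightarrow> a t \<le> 0"
    and t: "t \<notin> (\<Union>i\<in>{1..m}. periodize T {\<sigma> i, \<tau> i})"
  shows "\<exists>p q s. p < t \<and> t < q \<and> s \<in> {1, -1} \<and> (AE r in lebesgue. r \<in> {p<..<q} \<longrightarrow> s * a r \<ge> 0)"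
proof (cases "t \<in> (\<Union>i\<in>{1..m}. periodize T {\<sigma> i..\<tau> i})")
  case True
  then obtain i r k where i: "i \<in> {1..m}" and r: "r \<in> {\<sigma> i..\<tau> i}" "t = r + of_int k * T"
    unfolding periodize_def by blast
  have "t \<notin> periodize T {\<sigma> i, \<tau> i}"
    using t i by blast
  then have "r \<noteq> \<sigma> i" "r \<noteq> \<tau> i"
    using r(2) unfolding periodize_def by blast+
  then have "\<sigma> i + of_int k * T < t" "t < \<tau> i + of_int k * T"
    using r by auto
  moreover have "AE r in lebesgue. r \<in> {\<sigma> i + of_int k * T<..<\<tau> i + of_int k * T} \<longrightarrow> 1 * a r \<ge> 0"
    using AE_lebesgue_translate[OF a_pos[OF i], of "of_int k * T"]
  proof eventually_elim
    case (elim r)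
    interpret periodic_fun_simple a T
      by fact
    show ?case
      using elim minus_of_int[of r k] by auto
  qed
  ultimately show ?thesis
    by blast
next
  case False
  let ?P = "\<Union>i\<in>{1..m}. periodize T {\<sigma> i..\<tau> i}"
  have "open (- ?P)"
    by (intro open_Compl closed_UN ballI closed_periodize) auto
  then obtain e where e: "e > 0" "ball t e \<subseteq> - ?P"
    using False openE by (metis ComplI)
  have "AE r in lebesgue. r \<in> {t - e<..<t + e} \<longrightarrow> - 1 * a r \<ge> 0"
    using a_neg
  proof eventually_elim
    case (elim r)
    show ?case
    proof
      assume "r \<in> {t - e<..<t + e}"
      then have "r \<in> ball t e"
        by (auto simp: dist_real_def)
      then show "- 1 * a r \<ge> 0"
        using e(2) elim by auto
    qed
  qed
  then show ?thesis
    using e(1) by (intro exI[of _ "t - e"] exI[of _ "t + e"] exI[of _ "- 1"]) auto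
qed

lemma set_integral_pos_of_nontrivial:
  fixes a :: "real \<Rightarrow> real"
  assumes int: "set_integrable lebesgue {c..d} a" and "c < d"
    and nonneg: "AE t in lebesgue. t \<in> {c<..<d} \<longrightarrow> a t \<ge> 0"
    and nontriv: "\<not> (AE t in lebesgue. t \<in> {c<..<d} \<longrightarrow> a t = 0)"
  shows "(LINT t:{c..d}|lebesgue. a t) > 0"
proof -
  have ends: "AE t in lebesgue. t \<noteq> c \<and> t \<noteq> d"
    by (rule AE_I'[of "{c, d}"]) (use negligible_finite[of "{c, d}"] in \<open>auto simp: negligible_iff_null_sets\<close>)
  have ae: "AE t in lebesgue. 0 \<le> indicator {c..d} t * a t"
    using nonneg ends by eventually_elim (auto simp: indicator_def)
  have ia: "integrable lebesgue (\<lambda>t. indicator {c..d} t * a t)"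
    using int by (simp add: set_integrable_def)
  have "(LINT t:{c..d}|lebesgue. a t) \<noteq> 0"
  proof
    assume "(LINT t:{c..d}|lebesgue. a t) = 0"
    then have "AE t in lebesgue. indicator {c..d} t * a t = 0"
      using integral_nonneg_eq_0_iff_AE[OF ia ae] by (simp add: set_lebesgue_integral_def)
    then have "AE t in lebesgue. t \<in> {c<..<d} \<longrightarrow> a t = 0"
      by eventually_elim (auto simp: indicator_def)
    then show False
      using nontriv by blast
  qed
  moreover have "(LINT t:{c..d}|lebesgue. a t) \<ge> 0"
    using integral_nonneg_AE[OF ae] by (simp add: set_lebesgue_integral_def)
  ultimately show ?thesis
    by simp
qed

section \<open>The derivative of a limit of solutions\<close>

lemma phi_less:
  assumes "\<bar>x\<bar> < 1" "\<bar>y\<bar> < 1" "x < y"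
  shows "phi x < phi y"
proof -
  have pos: "1 - z\<^sup>2 > 0" if "\<bar>z\<bar> < 1" for z :: real
    using that by (simp add: abs_square_less_1)
  have nonneg: "phi x < phi y" if "0 \<le> x" "x < y" "y < 1" for x y
  proof -
    have "sqrt (1 - y\<^sup>2) \<le> sqrt (1 - x\<^sup>2)"
      using that by (simp add: power_mono)
    then show ?thesis
      unfolding phi_def using that pos[of x] pos[of y] by (intro frac_less) auto
  qed
  have odd: "phi (- z) = - phi z" for z
    by (simp add: phi_def)
  consider "0 \<le> x" | "y \<le> 0" | "x < 0" "0 < y"
    by linarith
  then show ?thesis
  proof cases
    case 1
    then show ?thesis
      using nonneg assms by auto
  next
    case 2
    then show ?thesis
      using nonneg[of "- y" "- x"] assms odd by auto
  next
    case 3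
    then have "phi x < 0" "phi y > 0"
      using pos assms by (auto simp: phi_def divide_neg_pos)
    then show ?thesis
      by simp
  qed
qed

lemma continuous_phi: "\<bar>L\<bar> < 1 \<Longrightarrow> isCont phi L"
  using abs_square_less_1[of L] unfolding phi_def[abs_def] by (intro continuous_intros) auto

text \<open>With \<open>s = 1\<close> or \<open>s = - 1\<close> according to the sign of \<open>a\<close>, the cases of a nonnegative and of a
  nonpositive weight are treated together. Taking \<open>\<kappa> = 0\<close> gives monotonicity of \<open>phi (deriv u)\<close>;
  a positive \<open>\<kappa>\<close> bounds its drop from below by a multiple of \<open>lam\<close>.\<close>

lemma signed_flux_decrement:
  assumes a: "locally_integrable a" and g: "continuous_on {0..} g"
    and sol: "is_solution lam a g u" and pos: "\<And>t. u t > 0" and lam: "lam > 0" and cd: "c \<le> d"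
    and sign: "AE t in lebesgue. t \<in> {c..d} \<longrightarrow> s * a t \<ge> 0"
    and \<kappa>: "\<And>t. t \<in> {c..d} \<Longrightarrow> \<kappa> \<le> g (u t)"
  shows "lam * (\<kappa> * (LINT t:{c..d}|lebesgue. s * a t)) \<le> s * (phi (deriv u c) - phi (deriv u d))"
proof -
  have int: "set_integrable lebesgue {c..d} (\<lambda>t. a t * g (u t))"
    and id: "phi (deriv u d) - phi (deriv u c) = - lam * (LINT t:{c..d}|lebesgue. a t * g (u t))"
    using solution_integral_identity[OF a g sol pos cd] by auto
  have ai: "set_integrable lebesgue {c..d} a"
    using a by (simp add: locally_integrable_def)
  have "\<kappa> * (LINT t:{c..d}|lebesgue. s * a t) = (LINT t:{c..d}|lebesgue. \<kappa> * (s * a t))"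
    by simp
  also have "\<dots> \<le> (LINT t:{c..d}|lebesgue. s * (a t * g (u t)))"
  proof (rule set_integral_mono_AE)
    show "set_integrable lebesgue {c..d} (\<lambda>t. \<kappa> * (s * a t))"
      using ai by (intro set_integrable_mult_right)
    show "set_integrable lebesgue {c..d} (\<lambda>t. s * (a t * g (u t)))"
      using int by (intro set_integrable_mult_right)
    show "AE t\<in>{c..d} in lebesgue. \<kappa> * (s * a t) \<le> s * (a t * g (u t))"
      using sign
    proof eventually_elim
      case (elim t)
      show ?case
      proof
        assume t: "t \<in> {c..d}"
        have "(s * a t) * \<kappa> \<le> (s * a t) * g (u t)"
          using elim t \<kappa> by (intro mult_left_mono) auto
        then show "\<kappa> * (s * a t) \<le> s * (a t * g (u t))"
          by (simp add: mult_ac)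
      qed
    qed
  qed
  also have "\<dots> = s * (LINT t:{c..d}|lebesgue. a t * g (u t))"
    by simp
  finally have "lam * (\<kappa> * (LINT t:{c..d}|lebesgue. s * a t)) \<le> lam * (s * (LINT t:{c..d}|lebesgue. a t * g (u t)))"
    using lam by (intro mult_left_mono) auto
  also have "\<dots> = s * (phi (deriv u c) - phi (deriv u d))"
  proof -
    have "lam * (LINT t:{c..d}|lebesgue. a t * g (u t)) = phi (deriv u c) - phi (deriv u d)"
      using id by simp
    then show ?thesis
      by (metis mult.left_commute)
  qed
  finally show ?thesis .
qed

text \<open>The functions \<open>- s u\<close> are convex on the interval, so the derivatives converge off a countable set
  \<open>C\<close>. The remaining points \<open>B\<close> to be excluded are those where the limit derivative is not -1, 0 or 1.
  Two of them cannot be joined by an interval on which \<open>U > 0\<close>: there the flux \<open>phi (deriv (u n))\<close>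
  would converge at both ends, while its drop is at least a fixed positive multiple of \<open>lam n\<close>.
  Since \<open>U\<close> is positive at each point of \<open>B\<close>, the set \<open>B\<close> is discrete.\<close>

lemma limit_derivative_on_signed_interval:
  fixes U :: "real \<Rightarrow> real" and u :: "nat \<Rightarrow> real \<Rightarrow> real"
  assumes a_locint: "locally_integrable a"
    and a_nontriv: "\<And>c d. c < d \<Longrightarrow> \<not> (AE t in lebesgue. t \<in> {c<..<d} \<longrightarrow> a t = 0)"
    and g_cont: "continuous_on {0..} g"
    and g_nonneg: "\<And>x. x \<ge> 0 \<Longrightarrow> g x \<ge> 0"
    and g_pos: "\<And>x. x > 0 \<Longrightarrow> g x > 0"
    and s: "s \<in> {1, -1}"
    and sign: "AE t in lebesgue. t \<in> {p<..<q} \<longrightarrow> s * a t \<ge> 0"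
    and lam_pos: "\<And>n. lam n > 0" and lam_lim: "filterlim lam at_top sequentially"
    and sol: "\<And>n. is_solution (lam n) a g (u n)" and pos: "\<And>n t. u n t > 0"
    and bdd: "\<And>n t. u n t \<le> K"
    and lim: "uniform_limit UNIV u U sequentially"
  shows "\<exists>C. countable C \<and> (\<forall>t\<in>{p<..<q} - C.
      \<exists>L\<in>{-1, 0, 1}. (U has_field_derivative L) (at t) \<and> (\<lambda>n. deriv (u n) t) \<longlonglongrightarrow> L)"
proof -
  have ptlim: "(\<lambda>n. u n t) \<longlonglongrightarrow> U t" for t
    by (rule tendsto_uniform_limitI[OF lim]) simp
  have U_nonneg: "U t \<ge> 0" for t
    by (rule LIMSEQ_le_const[OF ptlim]) (use pos in \<open>auto simp: less_imp_le\<close>)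
  have U_cont: "continuous_on S U" for S
  proof (rule continuous_on_subset)
    show "continuous_on UNIV U"
      by (rule uniform_limit_theorem[OF _ lim]) (use solution_continuous_on[OF sol] in auto)
  qed auto
  have der: "(u n has_field_derivative deriv (u n) t) (at t)" for n t
    by (rule solution_has_field_derivative[OF sol])
  have d1: "\<bar>deriv (u n) t\<bar> < 1" for n t
    using sol by (auto simp: is_solution_def)
  have sign_sub: "AE t in lebesgue. t \<in> {c..d} \<longrightarrow> s * a t \<ge> 0" if "p < c" "d < q" for c d
    using sign by eventually_elim (use that in auto)
  have s_mono: "mono_on {p<..<q} (\<lambda>t. - s * deriv (u n) t)" for n
  proof (rule mono_onI)
    fix c d
    assume cd: "c \<in> {p<..<q}" "d \<in> {p<..<q}" "c \<le> d"
    have "lam n * (0 * (LINT t:{c..d}|lebesgue. s * a t)) \<le> s * (phi (deriv (u n) c) - phi (deriv (u n) d))"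
      by (rule signed_flux_decrement[OF a_locint g_cont sol pos lam_pos cd(3) sign_sub])
         (use cd g_nonneg pos in \<open>auto simp: less_imp_le\<close>)
    then have flux: "s * phi (deriv (u n) d) \<le> s * phi (deriv (u n) c)"
      by (simp add: algebra_simps)
    show "- s * deriv (u n) c \<le> - s * deriv (u n) d"
      using s
    proof (elim insertE)
      assume "s = 1"
      then show ?thesis
        using flux phi_less[OF d1[of n c] d1[of n d]] by (cases "deriv (u n) d \<le> deriv (u n) c") auto
    next
      assume "s = - 1"
      then show ?thesis
        using flux phi_less[OF d1[of n d] d1[of n c]] by (cases "deriv (u n) c \<le> deriv (u n) d") auto
    qed auto
  qed
  obtain C where C: "countable C" and CL: "\<And>t. t \<in> {p<..<q} - C \<Longrightarrow>
      \<exists>L. ((\<lambda>t. - s * U t) has_field_derivative L) (at t) \<and> (\<lambda>n. - s * deriv (u n) t) \<longlonglongrightarrow> L"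
  proof -
    have "\<exists>C. countable C \<and> (\<forall>t\<in>{p<..<q} - C. \<exists>L. ((\<lambda>t. - s * U t) has_field_derivative L) (at t) \<and> (\<lambda>n. - s * deriv (u n) t) \<longlonglongrightarrow> L)"
    proof (rule convergence_of_monotone_derivatives[where f = "\<lambda>n t. - s * u n t" and B = 1])
      show "((\<lambda>t. - s * u n t) has_field_derivative - s * deriv (u n) t) (at t)" for n t
        by (intro DERIV_cmult der)
      show "\<bar>- s * deriv (u n) t\<bar> \<le> 1" for n t
        using s d1[of n t] by (auto simp: abs_mult)
      show "(\<lambda>n. - s * u n t) \<longlonglongrightarrow> - s * U t" for t
        by (intro tendsto_intros ptlim)
    qed (rule s_mono)
    then show thesis
      using that by blast
  qed
  have ss: "s * s = 1"
    using s by auto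
  have diff: "\<exists>L. (U has_field_derivative L) (at t) \<and> (\<lambda>n. deriv (u n) t) \<longlonglongrightarrow> L \<and> \<bar>L\<bar> \<le> 1"
    if t: "t \<in> {p<..<q} - C" for t
  proof -
    obtain L where L: "((\<lambda>t. - s * U t) has_field_derivative L) (at t)" "(\<lambda>n. - s * deriv (u n) t) \<longlonglongrightarrow> L"
      using CL[OF t] by blast
    have "((\<lambda>t. - s * (- s * U t)) has_field_derivative - s * L) (at t)"
      by (intro DERIV_cmult L)
    then have 1: "(U has_field_derivative - s * L) (at t)"
      using ss by (simp flip: mult.assoc)
    have "(\<lambda>n. - s * (- s * deriv (u n) t)) \<longlonglongrightarrow> - s * L"
      by (intro tendsto_intros L)
    then have 2: "(\<lambda>n. deriv (u n) t) \<longlonglongrightarrow> - s * L"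
      using ss by (simp flip: mult.assoc)
    have "\<bar>- s * L\<bar> \<le> 1"
      by (rule LIMSEQ_le_const2[OF tendsto_rabs[OF 2]]) (use d1 in \<open>auto simp: less_imp_le\<close>)
    with 1 2 show ?thesis
      by blast
  qed
  have separated: False
    if cd: "p < c" "c < d" "d < q" and Upos: "\<And>t. t \<in> {c..d} \<Longrightarrow> U t > 0"
      and Lc: "(\<lambda>n. deriv (u n) c) \<longlonglongrightarrow> Lc" "\<bar>Lc\<bar> < 1"
      and Ld: "(\<lambda>n. deriv (u n) d) \<longlonglongrightarrow> Ld" "\<bar>Ld\<bar> < 1" for c d Lc Ld
  proof -
    obtain t0 where t0: "t0 \<in> {c..d}" "\<And>t. t \<in> {c..d} \<Longrightarrow> U t0 \<le> U t"
      using continuous_attains_inf[OF _ _ U_cont, of "{c..d}"] cd by auto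
    define \<eta> where "\<eta> = U t0 / 2"
    have \<eta>: "\<eta> > 0"
      using Upos t0 by (simp add: \<eta>_def)
    have ev: "\<forall>\<^sub>F n in sequentially. \<forall>t\<in>{c..d}. \<eta> \<le> u n t"
      using uniform_limitD[OF lim \<eta>]
    proof eventually_elim
      case (elim n)
      show ?case
      proof
        fix t
        assume "t \<in> {c..d}"
        then have "2 * \<eta> \<le> U t"
          using t0 by (simp add: \<eta>_def)
        moreover have "\<bar>u n t - U t\<bar> < \<eta>"
          using elim by (simp add: dist_real_def)
        ultimately show "\<eta> \<le> u n t"
          by linarith
      qed
    qed
    \<comment> \<open>The maximum with \<open>\<eta>\<close> makes the interval \<open>{\<eta>..K'}\<close> nonempty.\<close>
    define K' where "K' = max K \<eta>"
    have "continuous_on {\<eta>..K'} g"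
      by (rule continuous_on_subset[OF g_cont]) (use \<eta> in auto)
    then obtain x0 where x0: "x0 \<in> {\<eta>..K'}" "\<And>x. x \<in> {\<eta>..K'} \<Longrightarrow> g x0 \<le> g x"
      using continuous_attains_inf[of "{\<eta>..K'}" g] by (auto simp: K'_def)
    define \<kappa> where "\<kappa> = g x0"
    have \<kappa>: "\<kappa> > 0"
      using g_pos x0(1) \<eta> by (simp add: \<kappa>_def)
    define I where "I = (LINT t:{c..d}|lebesgue. s * a t)"
    have I: "I > 0"
      unfolding I_def
    proof (rule set_integral_pos_of_nontrivial[OF _ cd(2)])
      show "set_integrable lebesgue {c..d} (\<lambda>t. s * a t)"
        using a_locint by (intro set_integrable_mult_right) (simp add: locally_integrable_def)
      show "AE t in lebesgue. t \<in> {c<..<d} \<longrightarrow> s * a t \<ge> 0"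
        using sign_sub[OF cd(1,3)] by eventually_elim auto
      show "\<not> (AE t in lebesgue. t \<in> {c<..<d} \<longrightarrow> s * a t = 0)"
        using a_nontriv[OF cd(2)] s by auto
    qed
    have "\<forall>\<^sub>F n in sequentially. lam n * (\<kappa> * I) \<le> s * (phi (deriv (u n) c) - phi (deriv (u n) d))"
      using ev
    proof eventually_elim
      case (elim n)
      show ?case
        unfolding I_def
      proof (rule signed_flux_decrement[OF a_locint g_cont sol pos lam_pos _ sign_sub])
        fix t
        assume "t \<in> {c..d}"
        then have "u n t \<in> {\<eta>..K'}"
          using elim bdd[of n t] by (auto simp: K'_def)
        then show "\<kappa> \<le> g (u n t)"
          using x0(2) by (simp add: \<kappa>_def)
      qed (use cd in auto)
    qed
    moreover have "filterlim (\<lambda>n. lam n * (\<kappa> * I)) at_top sequentially"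
      using filterlim_tendsto_pos_mult_at_top[OF tendsto_const _ lam_lim, of "\<kappa> * I"] \<kappa> I
      by (simp add: mult.commute)
    ultimately have "filterlim (\<lambda>n. s * (phi (deriv (u n) c) - phi (deriv (u n) d))) at_top sequentially"
      by (rule filterlim_at_top_mono[rotated])
    moreover have "(\<lambda>n. s * (phi (deriv (u n) c) - phi (deriv (u n) d))) \<longlonglongrightarrow> s * (phi Lc - phi Ld)"
      by (intro tendsto_intros isCont_tendsto_compose[OF continuous_phi] Lc Ld)
    ultimately show False
      using not_tendsto_and_filterlim_at_infinity[OF sequentially_bot] filterlim_at_top_imp_at_infinity by blast
  qed
  define B where "B = {t \<in> {p<..<q} - C. \<not> (\<exists>L\<in>{-1, 0, 1}. (U has_field_derivative L) (at t) \<and> (\<lambda>n. deriv (u n) t) \<longlonglongrightarrow> L)}"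
  have B: "U t > 0 \<and> (\<exists>L. (\<lambda>n. deriv (u n) t) \<longlonglongrightarrow> L \<and> \<bar>L\<bar> < 1)" if tB: "t \<in> B" for t
  proof -
    obtain L where L: "(U has_field_derivative L) (at t)" "(\<lambda>n. deriv (u n) t) \<longlonglongrightarrow> L" "\<bar>L\<bar> \<le> 1"
      using diff[of t] tB unfolding B_def by blast
    then have L': "L \<notin> {-1, 0, 1}"
      using tB by (auto simp: B_def)
    \<comment> \<open>Where \<open>U\<close> vanishes it attains its minimum, so its derivative there would be 0.\<close>
    have "U t \<noteq> 0"
    proof
      assume "U t = 0"
      then have "L = 0"
        using DERIV_local_min[OF L(1), of 1] U_nonneg by auto
      then show False
        using L' by simp
    qed
    moreover have "\<bar>L\<bar> < 1"
      using L(3) L' by (auto simp: abs_if split: if_splits)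
    ultimately show ?thesis
      using L(2) U_nonneg[of t] by auto
  qed
  have "countable B"
  proof (rule countable_if_locally_countable)
    fix t
    assume t: "t \<in> B"
    have "open {r. U r > 0}"
      using U_cont[of UNIV] by (intro open_Collect_less) auto
    then have "open ({r. U r > 0} \<inter> {p<..<q})"
      by auto
    moreover have "t \<in> {r. U r > 0} \<inter> {p<..<q}"
      using B[OF t] t by (auto simp: B_def)
    ultimately obtain e where e: "e > 0" "ball t e \<subseteq> {r. U r > 0} \<inter> {p<..<q}"
      by (meson openE)
    have near: "U r > 0 \<and> p < r \<and> r < q" if "r \<in> {t - e<..<t + e}" for r
      using e(2) that by (auto simp: ball_eq_greaterThanLessThan subset_iff)
    have no_pair: False if xy: "x \<in> B" "y \<in> B" "x < y" "x \<in> {t - e<..<t + e}" "y \<in> {t - e<..<t + e}" for x y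
    proof -
      obtain Lx Ly where "(\<lambda>n. deriv (u n) x) \<longlonglongrightarrow> Lx" "\<bar>Lx\<bar> < 1" "(\<lambda>n. deriv (u n) y) \<longlonglongrightarrow> Ly" "\<bar>Ly\<bar> < 1"
        using B[OF xy(1)] B[OF xy(2)] by blast
      then show False
        using separated[of x y Lx Ly] near xy by auto
    qed
    have "B \<inter> {t - e<..<t + e} \<subseteq> {t}"
    proof
      fix r
      assume r: "r \<in> B \<inter> {t - e<..<t + e}"
      then show "r \<in> {t}"
        using no_pair[of r t] no_pair[of t r] t e(1) by (cases r t rule: linorder_cases) auto
    qed
    then have "countable (B \<inter> {t - e<..<t + e})"
      by (rule countable_subset) simp
    then show "\<exists>p q. p < t \<and> t < q \<and> countable (B \<inter> {p<..<q})"
      using e(1) by (intro exI[of _ "t - e"] exI[of _ "t + e"]) auto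
  qed
  then show ?thesis
    using C by (intro exI[of _ "C \<union> B"]) (auto simp: B_def)
qed

section \<open>Uniqueness of periodic weak derivatives\<close>

lemma periodic_test_function_smooth:
  assumes "periodic_test_function T \<psi>"
  shows "(\<psi> has_field_derivative deriv \<psi> t) (at t)"
    and "continuous_on S \<psi>" and "continuous_on S (deriv \<psi>)" and "\<psi> T = \<psi> 0"
proof -
  have d: "(deriv ^^ k) \<psi> field_differentiable at t" for k t
    using assms by (simp add: periodic_test_function_def)
  show "(\<psi> has_field_derivative deriv \<psi> t) (at t)"
    using d[of 0 t] by (simp add: field_differentiable_derivI)
  show "continuous_on S \<psi>" "continuous_on S (deriv \<psi>)"
    using d[of 0] d[of 1]
    by (auto intro!: continuous_at_imp_continuous_on field_differentiable_imp_continuous_at)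
  show "\<psi> T = \<psi> 0"
    using periodic_fun_simple.plus_period[of \<psi> T 0] assms by (simp add: periodic_test_function_def)
qed

text \<open>The real part of an entire function is a convenient source of test functions, since
  differentiability of every order comes for free.\<close>

lemma periodic_test_function_Re_entire:
  assumes F: "F holomorphic_on UNIV" and per: "\<And>z. F (z + complex_of_real T) = F z"
  shows "periodic_test_function T (\<lambda>t. Re (F (complex_of_real t)))"
proof -
  have der: "((\<lambda>t. Re (G (complex_of_real t))) has_field_derivative Re (deriv G (complex_of_real t))) (at t)"
    if "G holomorphic_on UNIV" for G t
  proof -
    have "(G has_field_derivative deriv G (complex_of_real t)) (at (complex_of_real t))"
      by (rule holomorphic_derivI[OF that]) auto
    from has_vector_derivative_real_field[OF this]
    have "((\<lambda>t. G (complex_of_real t)) has_vector_derivative deriv G (complex_of_real t)) (at t)" .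
    from bounded_linear.has_vector_derivative[OF bounded_linear_Re this]
    show ?thesis
      by (simp add: has_real_derivative_iff_has_vector_derivative)
  qed
  have hol: "(deriv ^^ k) F holomorphic_on UNIV" for k
    by (intro holomorphic_higher_deriv F) auto
  have higher: "(deriv ^^ k) (\<lambda>t. Re (F (complex_of_real t))) = (\<lambda>t. Re ((deriv ^^ k) F (complex_of_real t)))" for k
  proof (induction k)
    case (Suc k)
    show ?case
      using DERIV_imp_deriv[OF der[OF hol[of k]]] by (auto simp: Suc)
  qed auto
  show ?thesis
    unfolding periodic_test_function_def higher
  proof (intro conjI allI)
    show "(\<lambda>t. Re ((deriv ^^ k) F (complex_of_real t))) field_differentiable at t" for k t
      using der[OF hol[of k]] by (auto simp: field_differentiable_def)
    show "periodic_fun_simple (\<lambda>t. Re (F (complex_of_real t))) T"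
      by standard (simp add: per)
  qed
qed

lemma exp_neg_exp_tendsto_step:
  fixes s :: real
  shows "s > 0 \<Longrightarrow> (\<lambda>n. exp (- exp (- (real n * s)))) \<longlonglongrightarrow> 1"
    and "s < 0 \<Longrightarrow> (\<lambda>n. exp (- exp (- (real n * s)))) \<longlonglongrightarrow> 0"
proof -
  assume "s > 0"
  then have "(\<lambda>n. exp (- s) ^ n) \<longlonglongrightarrow> 0"
    by (intro LIMSEQ_power_zero) auto
  then have "(\<lambda>n. exp (- (exp (- s) ^ n))) \<longlonglongrightarrow> exp (- 0)"
    by (intro tendsto_exp tendsto_minus)
  then show "(\<lambda>n. exp (- exp (- (real n * s)))) \<longlonglongrightarrow> 1"
    by (simp flip: exp_of_nat_mult)
next
  assume "s < 0"
  then have lim: "(\<lambda>n. exp s ^ n) \<longlonglongrightarrow> 0"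
    by (intro LIMSEQ_power_zero) auto
  show "(\<lambda>n. exp (- exp (- (real n * s)))) \<longlonglongrightarrow> 0"
  proof (rule tendsto_sandwich[OF _ _ tendsto_const lim])
    show "\<forall>\<^sub>F n in sequentially. exp (- exp (- (real n * s))) \<le> exp s ^ n"
    proof (rule always_eventually, rule allI)
      fix n :: nat
      have "- exp (- (real n * s)) \<le> real n * s"
        using exp_ge_add_one_self[of "- (real n * s)"] by linarith
      then show "exp (- exp (- (real n * s))) \<le> exp s ^ n"
        by (simp flip: exp_of_nat_mult)
    qed
  qed auto
qed

text \<open>On \<open>(0, T)\<close> the trigonometric polynomial \<open>cos (\<omega> (t - m)) - b\<close>, with \<open>\<omega> = 2 pi / T\<close> and \<open>m\<close> the midpoint of
  \<open>(c, T)\<close>, is positive exactly on \<open>(c, T)\<close> and vanishes only at \<open>c\<close>. The functions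
  \<open>exp (- exp (- n x))\<close> of its value \<open>x\<close> are entire, take values in \<open>(0, 1)\<close> on the real line, and tend
  to 1 for \<open>x > 0\<close> and to 0 for \<open>x < 0\<close>.\<close>

lemma periodic_test_functions_tendsto_indicator:
  fixes T c :: real
  assumes c: "0 \<le> c" "c < T"
  obtains \<psi> :: "nat \<Rightarrow> real \<Rightarrow> real" where
    "\<And>n. periodic_test_function T (\<psi> n)" "\<And>n. continuous_on UNIV (\<psi> n)" "\<And>n t. \<bar>\<psi> n t\<bar> \<le> 1"
    "\<And>t. 0 < t \<Longrightarrow> t < T \<Longrightarrow> t \<noteq> c \<Longrightarrow> (\<lambda>n. \<psi> n t) \<longlonglongrightarrow> indicator {c<..} t"
proof -
  define \<omega> where "\<omega> = 2 * pi / T"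
  define m where "m = (c + T) / 2"
  define b where "b = cos (\<omega> * ((T - c) / 2))"
  have T: "T > 0"
    using c by simp
  have \<omega>: "\<omega> > 0" "\<omega> * T = 2 * pi"
    using T by (auto simp: \<omega>_def)
  define F where "F n z = exp (- exp (- (of_nat n * (cos (of_real \<omega> * (z - of_real m)) - of_real b))))"
    for n :: nat and z :: complex
  define \<psi> where "\<psi> n t = exp (- exp (- (real n * (cos (\<omega> * (t - m)) - b))))" for n t
  have \<psi>F: "\<psi> n = (\<lambda>t. Re (F n (complex_of_real t)))" for n
  proof
    fix t
    have "F n (complex_of_real t) = complex_of_real (\<psi> n t)"
      by (simp add: F_def \<psi>_def flip: exp_of_real cos_of_real)
    then show "\<psi> n t = Re (F n (complex_of_real t))"
      by simp
  qed
  have per: "F n (z + complex_of_real T) = F n z" for n z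
  proof -
    have "cos (of_real \<omega> * (z + of_real T - of_real m)) = cos (of_real \<omega> * (z - of_real m) + of_real (\<omega> * T))"
      by (simp add: algebra_simps)
    also have "\<dots> = cos (of_real \<omega> * (z - of_real m))"
      unfolding \<omega>(2) by (simp add: cos_add flip: cos_of_real sin_of_real)
    finally show ?thesis
      by (simp add: F_def)
  qed
  show thesis
  proof (rule that)
    show "periodic_test_function T (\<psi> n)" for n
    proof -
      have "F n holomorphic_on UNIV"
        unfolding F_def by (intro holomorphic_intros)
      then show ?thesis
        unfolding \<psi>F by (rule periodic_test_function_Re_entire) (rule per)
    qed
    show "continuous_on UNIV (\<psi> n)" for n
      unfolding \<psi>_def by (intro continuous_intros)
    show "\<bar>\<psi> n t\<bar> \<le> 1" for n t
      unfolding \<psi>_def by simp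
    fix t
    assume t: "0 < t" "t < T" "t \<noteq> c"
    define y where "y = \<omega> * ((T - c) / 2)"
    have y: "0 < y" "y \<le> pi"
      using \<omega> c mult_left_mono[of "T - c" T \<omega>] by (auto simp: y_def)
    show "(\<lambda>n. \<psi> n t) \<longlonglongrightarrow> indicator {c<..} t"
    proof (cases "c < t")
      case True
      then have "\<bar>t - m\<bar> < (T - c) / 2"
        using t by (auto simp: m_def abs_if field_simps)
      then have "\<bar>\<omega> * (t - m)\<bar> < y"
        using \<omega> by (simp add: y_def abs_mult)
      then have "cos \<bar>\<omega> * (t - m)\<bar> > cos y"
        using y by (intro cos_monotone_0_pi) auto
      then show ?thesis
        using True exp_neg_exp_tendsto_step(1)[of "cos (\<omega> * (t - m)) - b"]
        by (simp add: \<psi>_def b_def y_def)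
    next
      case False
      \<comment> \<open>The upper bound \<open>2 pi - y\<close> keeps \<open>x\<close> from re-entering the region \<open>cos x > cos y\<close> of the next period.\<close>
      define x where "x = \<omega> * (m - t)"
      have "(T - c) / 2 < m - t" "m - t < T - (T - c) / 2"
        using t False by (auto simp: m_def field_simps)
      then have "y < x" "x < \<omega> * (T - (T - c) / 2)"
        using \<omega> by (auto simp: y_def x_def)
      then have x: "y < x" "x < 2 * pi - y"
        using \<omega>(2) by (auto simp: y_def right_diff_distrib)
      have "cos x < cos y"
      proof (cases "x \<le> pi")
        case True
        then show ?thesis
          using x y by (intro cos_monotone_0_pi) auto
      next
        case False
        then have "cos (2 * pi - x) < cos y"
          using x y by (intro cos_monotone_0_pi) auto
        then show ?thesis
          by simp
      qed
      moreover have "cos x = cos (\<omega> * (t - m))"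
        by (metis cos_minus minus_diff_eq mult_minus_right x_def)
      ultimately show ?thesis
        using False exp_neg_exp_tendsto_step(2)[of "cos (\<omega> * (t - m)) - b"]
        by (simp add: \<psi>_def b_def y_def)
    qed
  qed
qed

text \<open>The positive and the negative part of \<open>f\<close> are densities of two finite measures that agree on all
  half-lines, hence on all Borel sets, so they coincide almost everywhere. Since half-lines generate
  only the Borel sets, \<open>f\<close> is first replaced by a Borel function.\<close>

lemma AE_zero_if_integral_greaterThan_zero:
  fixes f :: "real \<Rightarrow> real"
  assumes f: "integrable lebesgue f"
    and zero: "\<And>x. (\<integral>t. f t * indicator {x<..} t \<partial>lebesgue) = 0"
  shows "AE t in lebesgue. f t = 0"
proof -
  have fm: "f \<in> borel_measurable lebesgue"
    using f by auto
  obtain h where h: "h \<in> borel_measurable lborel" and fh: "AE t in lborel. f t = h t"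
    using completion_ex_borel_measurable_real[OF fm] by blast
  note [measurable] = h[simplified]
  have fh': "AE t in lebesgue. f t = h t"
    using fh by (rule AE_completion)
  have hint: "integrable lborel h"
  proof -
    have "integrable lebesgue h"
      using integrable_cong_AE[THEN iffD1, OF fm _ fh' f] h by (simp add: measurable_completion)
    then show ?thesis
      using h by (simp add: integrable_completion)
  qed
  have h0: "(\<integral>t. h t * indicator {x<..} t \<partial>lborel) = 0" for x
  proof -
    have "(\<integral>t. h t * indicator {x<..} t \<partial>lborel) = (\<integral>t. h t * indicator {x<..} t \<partial>lebesgue)"
      by (subst integral_completion) auto
    also have "\<dots> = (\<integral>t. f t * indicator {x<..} t \<partial>lebesgue)"
    proof (rule integral_cong_AE)
      show "(\<lambda>t. h t * indicator {x<..} t) \<in> borel_measurable lebesgue"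
        by (rule measurable_completion) simp
      show "(\<lambda>t. f t * indicator {x<..} t) \<in> borel_measurable lebesgue"
        using fm by (intro borel_measurable_times borel_measurable_indicator) auto
    qed (use fh' in auto)
    finally show ?thesis
      using zero by simp
  qed
  let ?p = "\<lambda>t. ennreal (h t)" and ?n = "\<lambda>t. ennreal (- h t)"
  have pn: "(\<integral>\<^sup>+t. ?p t * indicator {x<..} t \<partial>lborel) = (\<integral>\<^sup>+t. ?n t * indicator {x<..} t \<partial>lborel)"
    "(\<integral>\<^sup>+t. ?p t * indicator {x<..} t \<partial>lborel) < \<infinity>" for x
  proof -
    have ip: "integrable lborel (\<lambda>t. max 0 (h t) * indicator {x<..} t)"
      "integrable lborel (\<lambda>t. max 0 (- h t) * indicator {x<..} t)"
      using hint by (auto intro!: integrable_real_mult_indicator integrable_max)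
    have "(\<integral>t. max 0 (h t) * indicator {x<..} t \<partial>lborel) - (\<integral>t. max 0 (- h t) * indicator {x<..} t \<partial>lborel)
        = (\<integral>t. max 0 (h t) * indicator {x<..} t - max 0 (- h t) * indicator {x<..} t \<partial>lborel)"
      using ip by simp
    also have "\<dots> = (\<integral>t. h t * indicator {x<..} t \<partial>lborel)"
      by (intro Bochner_Integration.integral_cong) (auto simp: indicator_def)
    finally have eq: "(\<integral>t. max 0 (h t) * indicator {x<..} t \<partial>lborel) = (\<integral>t. max 0 (- h t) * indicator {x<..} t \<partial>lborel)"
      using h0[of x] by simp
    have P: "(\<integral>\<^sup>+t. ?p t * indicator {x<..} t \<partial>lborel) = ennreal (\<integral>t. max 0 (h t) * indicator {x<..} t \<partial>lborel)"
      by (subst nn_integral_eq_integral[OF ip(1), symmetric])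
         (auto intro!: nn_integral_cong simp: indicator_def max_def ennreal_neg)
    have Q: "(\<integral>\<^sup>+t. ?n t * indicator {x<..} t \<partial>lborel) = ennreal (\<integral>t. max 0 (- h t) * indicator {x<..} t \<partial>lborel)"
      by (subst nn_integral_eq_integral[OF ip(2), symmetric])
         (auto intro!: nn_integral_cong simp: indicator_def max_def ennreal_neg)
    show "(\<integral>\<^sup>+t. ?p t * indicator {x<..} t \<partial>lborel) = (\<integral>\<^sup>+t. ?n t * indicator {x<..} t \<partial>lborel)"
      "(\<integral>\<^sup>+t. ?p t * indicator {x<..} t \<partial>lborel) < \<infinity>"
      unfolding P Q eq by auto
  qed
  have "density lborel ?p = density lborel ?n"
    by (rule measure_eqI_lessThan) (use pn in \<open>auto simp: emeasure_density\<close>)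
  then have "AE t in lborel. ?p t = ?n t"
    by (subst (asm) sigma_finite_measure.density_unique_iff[OF lborel.sigma_finite_measure_axioms]) auto
  then have "AE t in lborel. h t = 0"
  proof (rule AE_mp, intro AE_I2 impI)
    fix t
    assume "?p t = ?n t"
    then show "h t = 0"
      by (cases "h t \<ge> 0") (auto simp: ennreal_neg ennreal_eq_0_iff)
  qed
  then have "AE t in lebesgue. h t = 0"
    by (rule AE_completion)
  with fh' show ?thesis
    by auto
qed

text \<open>Dominated convergence along test functions that approximate the indicator of a half-line shows that
  \<open>v\<close> has zero integral over each \<open>(c, T)\<close>.\<close>

lemma AE_zero_if_orthogonal_to_test_functions:
  assumes T: "T > 0" and v: "set_integrable lebesgue {0..T} v"
    and orth: "\<And>\<psi>. periodic_test_function T \<psi> \<Longrightarrow> (LINT t:{0..T}|lebesgue. v t * \<psi> t) = 0"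
  shows "AE t in lebesgue. t \<in> {0..T} \<longrightarrow> v t = 0"
proof -
  let ?V = "\<lambda>t. indicator {0..T} t * v t"
  have V: "integrable lebesgue ?V"
    using v by (simp add: set_integrable_def)
  have ind: "indicat_real {c<..} \<in> borel_measurable lebesgue" for c :: real
    by (rule measurable_completion) simp
  have base: "(\<integral>t. ?V t * indicator {c<..} t \<partial>lebesgue) = 0" if c: "0 \<le> c" "c < T" for c
  proof -
    obtain \<psi> :: "nat \<Rightarrow> real \<Rightarrow> real" where \<psi>: "\<And>n. periodic_test_function T (\<psi> n)" "\<And>n. continuous_on UNIV (\<psi> n)"
      "\<And>n t. \<bar>\<psi> n t\<bar> \<le> 1"
      "\<And>t. 0 < t \<Longrightarrow> t < T \<Longrightarrow> t \<noteq> c \<Longrightarrow> (\<lambda>n. \<psi> n t) \<longlonglongrightarrow> indicator {c<..} t"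
      using periodic_test_functions_tendsto_indicator[OF c] by blast
    have "(\<lambda>n. \<integral>t. ?V t * \<psi> n t \<partial>lebesgue) \<longlonglongrightarrow> (\<integral>t. ?V t * indicator {c<..} t \<partial>lebesgue)"
    proof (rule integral_dominated_convergence)
      show "integrable lebesgue (\<lambda>t. \<bar>?V t\<bar>)"
        using V by (rule integrable_abs)
      show "(\<lambda>t. ?V t * indicator {c<..} t) \<in> borel_measurable lebesgue"
        by (intro borel_measurable_times[OF borel_measurable_integrable[OF V]] ind)
      show "(\<lambda>t. ?V t * \<psi> n t) \<in> borel_measurable lebesgue" for n
      proof (rule borel_measurable_times)
        show "\<psi> n \<in> borel_measurable lebesgue"
          using borel_measurable_continuous_onI[OF \<psi>(2)] by (simp add: measurable_completion)
      qed (rule borel_measurable_integrable[OF V])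
      show "AE t in lebesgue. (\<lambda>n. ?V t * \<psi> n t) \<longlonglongrightarrow> ?V t * indicator {c<..} t"
      proof (rule AE_I'[of "{0, c, T}"])
        show "{0, c, T} \<in> null_sets lebesgue"
          using negligible_finite[of "{0, c, T}"] by (simp add: negligible_iff_null_sets)
        show "{t \<in> space lebesgue. \<not> (\<lambda>n. ?V t * \<psi> n t) \<longlonglongrightarrow> ?V t * indicator {c<..} t} \<subseteq> {0, c, T}"
        proof (safe, rule ccontr)
          fix t
          assume nconv: "\<not> (\<lambda>n. ?V t * \<psi> n t) \<longlonglongrightarrow> ?V t * indicator {c<..} t"
            and t: "t \<noteq> 0" "t \<noteq> T" "t \<noteq> c"
          show False
          proof (cases "t \<in> {0..T}")
            case True
            then show False
              using nconv tendsto_mult_left[OF \<psi>(4)[of t], of "?V t"] t by auto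
          qed (use nconv in auto)
        qed
      qed
      show "AE t in lebesgue. norm (?V t * \<psi> n t) \<le> \<bar>?V t\<bar>" for n
        using \<psi>(3)[of n] by (auto simp: abs_mult mult_left_le)
    qed
    moreover have "(\<integral>t. ?V t * \<psi> n t \<partial>lebesgue) = 0" for n
      using orth[OF \<psi>(1)[of n]] by (simp add: set_lebesgue_integral_def mult.assoc)
    ultimately have "(\<lambda>n. 0) \<longlonglongrightarrow> (\<integral>t. ?V t * indicator {c<..} t \<partial>lebesgue)"
      by simp
    then show ?thesis
      by (rule LIMSEQ_unique[OF _ tendsto_const])
  qed
  have "(\<integral>t. ?V t * indicator {c<..} t \<partial>lebesgue) = 0" for c
  proof -
    consider "c < 0" | "0 \<le> c" "c < T" | "T \<le> c"
      by linarith
    then show ?thesis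
    proof cases
      \<comment> \<open>The integrand vanishes to the left of 0, so this reduces to \<open>c = 0\<close>.\<close>
      case 1
      have ae: "AE t in lebesgue. t \<noteq> (0::real)"
        by (rule AE_I'[of "{0}"]) (use negligible_sing[of "0::real"] in \<open>auto simp: negligible_iff_null_sets\<close>)
      have "(\<integral>t. ?V t * indicator {c<..} t \<partial>lebesgue) = (\<integral>t. ?V t * indicator {0<..} t \<partial>lebesgue)"
      proof (rule integral_cong_AE)
        show "AE t in lebesgue. ?V t * indicator {c<..} t = ?V t * indicator {0<..} t"
          using ae by eventually_elim (use 1 in \<open>auto simp: indicator_def\<close>)
      qed (intro borel_measurable_times[OF borel_measurable_integrable[OF V]] ind)+
      then show ?thesis
        using base[of 0] T by simp
    next
      case 3
      then have "(\<lambda>t. ?V t * indicator {c<..} t) = (\<lambda>t. 0)"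
        by (auto simp: indicator_def fun_eq_iff)
      then show ?thesis
        by simp
    qed (rule base)
  qed
  from AE_zero_if_integral_greaterThan_zero[OF V this]
  show ?thesis
    by (auto simp: indicator_def)
qed

lemma weak_derivative_unique:
  assumes T: "T > 0" and "weak_derivative T u v" "weak_derivative T u w"
  shows "AE t in lebesgue. t \<in> {0..T} \<longrightarrow> v t = w t"
proof -
  have vw: "set_integrable lebesgue {0..T} v" "set_integrable lebesgue {0..T} w"
    using assms by (auto simp: weak_derivative_def)
  have "AE t in lebesgue. t \<in> {0..T} \<longrightarrow> v t - w t = 0"
  proof (rule AE_zero_if_orthogonal_to_test_functions[OF T])
    fix \<psi>
    assume \<psi>: "periodic_test_function T \<psi>"
    note int\<psi> = set_integrable_mult_continuous[OF _ periodic_test_function_smooth(2)[OF \<psi>]]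
    have "(LINT t:{0..T}|lebesgue. v t * \<psi> t - w t * \<psi> t) = 0"
      using assms(2,3) \<psi> set_integral_diff(2)[OF int\<psi>[OF vw(1)] int\<psi>[OF vw(2)]]
      by (auto simp: weak_derivative_def)
    then show "(LINT t:{0..T}|lebesgue. (v t - w t) * \<psi> t) = 0"
      by (simp add: left_diff_distrib)
  qed (intro set_integral_diff vw)
  then show ?thesis
    by simp
qed

section \<open>Convergence in the periodic Sobolev space\<close>

lemma weak_derivative_of_periodic_C1:
  fixes u u' :: "real \<Rightarrow> real"
  assumes T: "T > 0" and per: "periodic_fun_simple u T"
    and der: "\<And>t. (u has_field_derivative u' t) (at t)" and cont: "continuous_on UNIV u'"
  shows "weak_derivative T u u'"
  unfolding weak_derivative_def
proof (intro conjI allI impI)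
  have uc: "continuous_on {0..T} u"
    using der by (meson DERIV_isCont continuous_at_imp_continuous_on)
  have u'c: "continuous_on {0..T} u'"
    using cont continuous_on_subset by blast
  show "set_integrable lebesgue {0..T} u" "set_integrable lebesgue {0..T} u'"
    by (intro absolutely_integrable_continuous_real uc u'c)+
  fix \<psi>
  assume \<psi>: "periodic_test_function T \<psi>"
  note \<psi>s = periodic_test_function_smooth[OF \<psi>]
  have i1: "set_integrable lebesgue {0..T} (\<lambda>t. u t * deriv \<psi> t)"
    by (intro absolutely_integrable_continuous_real continuous_intros uc \<psi>s)
  have i2: "set_integrable lebesgue {0..T} (\<lambda>t. u' t * \<psi> t)"
    by (intro absolutely_integrable_continuous_real continuous_intros u'c \<psi>s)
  have "((\<lambda>t. u t * deriv \<psi> t + u' t * \<psi> t) has_integral (u T * \<psi> T - u 0 * \<psi> 0)) {0..T}"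
  proof (rule fundamental_theorem_of_calculus)
    fix t
    have "((\<lambda>t. u t * \<psi> t) has_field_derivative u t * deriv \<psi> t + u' t * \<psi> t) (at t)"
      using DERIV_mult[OF der \<psi>s(1)] by (simp add: algebra_simps)
    then show "((\<lambda>t. u t * \<psi> t) has_vector_derivative u t * deriv \<psi> t + u' t * \<psi> t) (at t within {0..T})"
      by (simp add: has_real_derivative_iff_has_vector_derivative has_vector_derivative_at_within)
  qed (use T in simp)
  moreover have "u T = u 0"
    using periodic_fun_simple.plus_period[OF per, of 0] by simp
  ultimately have "((\<lambda>t. u t * deriv \<psi> t + u' t * \<psi> t) has_integral 0) {0..T}"
    using \<psi>s(4) by simp
  moreover have "((\<lambda>t. u t * deriv \<psi> t + u' t * \<psi> t) has_integral
      (LINT t:{0..T}|lebesgue. u t * deriv \<psi> t) + (LINT t:{0..T}|lebesgue. u' t * \<psi> t)) {0..T}"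
    by (intro has_integral_add has_integral_set_lebesgue i1 i2)
  ultimately have "(LINT t:{0..T}|lebesgue. u t * deriv \<psi> t) + (LINT t:{0..T}|lebesgue. u' t * \<psi> t) = 0"
    by (rule has_integral_unique[symmetric])
  then show "(LINT t:{0..T}|lebesgue. u t * deriv \<psi> t) = - (LINT t:{0..T}|lebesgue. u' t * \<psi> t)"
    by simp
qed

text \<open>Dominated convergence on one period with a constant majorant. The first conclusion also serves as an
  integrability criterion, with a constant sequence.\<close>

lemma bounded_convergence:
  fixes f :: "nat \<Rightarrow> real \<Rightarrow> real"
  assumes meas: "\<And>n. f n \<in> borel_measurable lebesgue" "F \<in> borel_measurable lebesgue"
    and bound: "\<And>n. AE t in lebesgue. t \<in> {0..T} \<longrightarrow> \<bar>f n t\<bar> \<le> B"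
    and lim: "AE t in lebesgue. t \<in> {0..T} \<longrightarrow> (\<lambda>n. f n t) \<longlonglongrightarrow> F t"
  shows "set_integrable lebesgue {0..T} F"
    and "(\<lambda>n. LINT t:{0..T}|lebesgue. f n t) \<longlonglongrightarrow> (LINT t:{0..T}|lebesgue. F t)"
proof -
  have ind: "indicat_real {0..T} \<in> borel_measurable lebesgue"
    by (rule measurable_completion) simp
  have m: "(\<lambda>t. indicator {0..T} t *\<^sub>R h t) \<in> borel_measurable lebesgue"
    if "h \<in> borel_measurable lebesgue" for h :: "real \<Rightarrow> real"
    using borel_measurable_scaleR[OF ind that] .
  have w: "integrable lebesgue (\<lambda>t. indicator {0..T} t *\<^sub>R B)"
    using absolutely_integrable_continuous_real[of 0 T "\<lambda>t. B"] by (simp add: set_integrable_def)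
  have l: "AE t in lebesgue. (\<lambda>n. indicator {0..T} t *\<^sub>R f n t) \<longlonglongrightarrow> indicator {0..T} t *\<^sub>R F t"
    using lim by eventually_elim (auto simp: indicator_def)
  have b: "AE t in lebesgue. norm (indicator {0..T} t *\<^sub>R f n t) \<le> indicator {0..T} t *\<^sub>R B" for n
    using bound[of n] by eventually_elim (auto simp: indicator_def)
  show "set_integrable lebesgue {0..T} F"
    unfolding set_integrable_def by (rule integrable_dominated_convergence[OF m[OF meas(2)] m[OF meas(1)] w l b])
  show "(\<lambda>n. LINT t:{0..T}|lebesgue. f n t) \<longlonglongrightarrow> (LINT t:{0..T}|lebesgue. F t)"
    unfolding set_lebesgue_integral_def
    by (rule integral_dominated_convergence[OF m[OF meas(2)] m[OF meas(1)] w l b])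
qed

lemma bounded_on_period:
  assumes "continuous_on {0..T} (\<psi> :: real \<Rightarrow> real)"
  obtains B where "\<And>t. t \<in> {0..T} \<Longrightarrow> \<bar>\<psi> t\<bar> \<le> B" "B \<ge> 0"
proof -
  have "bounded (\<psi> ` {0..T})"
    by (intro compact_imp_bounded compact_continuous_image assms) auto
  then obtain B where "B > 0" "\<forall>x\<in>\<psi> ` {0..T}. norm x \<le> B"
    using bounded_pos by blast
  then show thesis
    using that[of B] by auto
qed

text \<open>The defining identity of the weak derivative passes to the limit under bounded convergence, so the
  almost everywhere limit of the derivatives is the weak derivative of the limit function, with no
  integration by parts for Lipschitz functions.\<close>

lemma weak_derivative_limit:
  fixes f v :: "nat \<Rightarrow> real \<Rightarrow> real"
  assumes wd: "\<And>n. weak_derivative T (f n) (v n)"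
    and fm: "\<And>n. f n \<in> borel_measurable lebesgue" "F \<in> borel_measurable lebesgue"
    and vm: "\<And>n. v n \<in> borel_measurable lebesgue" "V \<in> borel_measurable lebesgue"
    and fb: "\<And>n t. \<bar>f n t\<bar> \<le> K" and vb: "\<And>n t. \<bar>v n t\<bar> \<le> K"
    and fl: "\<And>t. (\<lambda>n. f n t) \<longlonglongrightarrow> F t" and vl: "AE t in lebesgue. (\<lambda>n. v n t) \<longlonglongrightarrow> V t"
  shows "weak_derivative T F V"
  unfolding weak_derivative_def
proof (intro conjI allI impI)
  show "set_integrable lebesgue {0..T} F"
    by (rule bounded_convergence(1)[where f = f and B = K, OF fm]) (use fb fl in auto)
  show "set_integrable lebesgue {0..T} V"
    by (rule bounded_convergence(1)[where f = v and B = K, OF vm]) (use vb vl in auto)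
  fix \<psi>
  assume \<psi>: "periodic_test_function T \<psi>"
  note \<psi>s = periodic_test_function_smooth[OF \<psi>]
  have \<psi>m: "\<psi> \<in> borel_measurable lebesgue" "deriv \<psi> \<in> borel_measurable lebesgue"
    using borel_measurable_continuous_onI[OF \<psi>s(2)] borel_measurable_continuous_onI[OF \<psi>s(3)]
    by (auto intro: measurable_completion)
  obtain B0 where B0: "\<And>t. t \<in> {0..T} \<Longrightarrow> \<bar>\<psi> t\<bar> \<le> B0" "B0 \<ge> 0"
    using bounded_on_period[OF \<psi>s(2)] by blast
  obtain B1 where B1: "\<And>t. t \<in> {0..T} \<Longrightarrow> \<bar>deriv \<psi> t\<bar> \<le> B1" "B1 \<ge> 0"
    using bounded_on_period[OF \<psi>s(3)] by blast
  have "(\<lambda>n. LINT t:{0..T}|lebesgue. f n t * deriv \<psi> t) \<longlonglongrightarrow> (LINT t:{0..T}|lebesgue. F t * deriv \<psi> t)"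
  proof (rule bounded_convergence(2)[where B = "K * B1"])
    show "AE t in lebesgue. t \<in> {0..T} \<longrightarrow> \<bar>f n t * deriv \<psi> t\<bar> \<le> K * B1" for n
      using fb[of n] B1 by (auto simp: abs_mult intro!: mult_mono' AE_I2)
    show "AE t in lebesgue. t \<in> {0..T} \<longrightarrow> (\<lambda>n. f n t * deriv \<psi> t) \<longlonglongrightarrow> F t * deriv \<psi> t"
      by (auto intro!: AE_I2 tendsto_mult_right fl)
  qed (intro borel_measurable_times fm \<psi>m)+
  moreover have "(\<lambda>n. - (LINT t:{0..T}|lebesgue. v n t * \<psi> t)) \<longlonglongrightarrow> - (LINT t:{0..T}|lebesgue. V t * \<psi> t)"
  proof (rule tendsto_minus[OF bounded_convergence(2)[where B = "K * B0"]])
    show "AE t in lebesgue. t \<in> {0..T} \<longrightarrow> \<bar>v n t * \<psi> t\<bar> \<le> K * B0" for n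
      using vb[of n] B0 by (auto simp: abs_mult intro!: mult_mono' AE_I2)
    show "AE t in lebesgue. t \<in> {0..T} \<longrightarrow> (\<lambda>n. v n t * \<psi> t) \<longlonglongrightarrow> V t * \<psi> t"
      using vl by eventually_elim (auto intro!: tendsto_mult_right)
  qed (intro borel_measurable_times vm \<psi>m)+
  moreover have "(LINT t:{0..T}|lebesgue. f n t * deriv \<psi> t) = - (LINT t:{0..T}|lebesgue. v n t * \<psi> t)" for n
    using wd[of n] \<psi> by (simp add: weak_derivative_def)
  ultimately show "(LINT t:{0..T}|lebesgue. F t * deriv \<psi> t) = - (LINT t:{0..T}|lebesgue. V t * \<psi> t)"
    using LIMSEQ_unique by auto
qed

lemma weak_derivative_diff:
  assumes f: "weak_derivative T f v" and h: "weak_derivative T h w"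
  shows "weak_derivative T (\<lambda>t. f t - h t) (\<lambda>t. v t - w t)"
  unfolding weak_derivative_def
proof (intro conjI allI impI)
  have int: "set_integrable lebesgue {0..T} f" "set_integrable lebesgue {0..T} h"
    "set_integrable lebesgue {0..T} v" "set_integrable lebesgue {0..T} w"
    using assms by (auto simp: weak_derivative_def)
  show "set_integrable lebesgue {0..T} (\<lambda>t. f t - h t)" "set_integrable lebesgue {0..T} (\<lambda>t. v t - w t)"
    by (intro set_integral_diff int)+
  fix \<psi>
  assume \<psi>: "periodic_test_function T \<psi>"
  note \<psi>s = periodic_test_function_smooth[OF \<psi>]
  note int\<psi> = set_integrable_mult_continuous[OF _ \<psi>s(2)] and int\<psi>' = set_integrable_mult_continuous[OF _ \<psi>s(3)]
  have "(LINT t:{0..T}|lebesgue. (f t - h t) * deriv \<psi> t)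
      = (LINT t:{0..T}|lebesgue. f t * deriv \<psi> t) - (LINT t:{0..T}|lebesgue. h t * deriv \<psi> t)"
    using set_integral_diff(2)[OF int\<psi>'[OF int(1)] int\<psi>'[OF int(2)]] by (simp add: left_diff_distrib)
  also have "\<dots> = - ((LINT t:{0..T}|lebesgue. v t * \<psi> t) - (LINT t:{0..T}|lebesgue. w t * \<psi> t))"
    using assms \<psi> by (simp add: weak_derivative_def)
  also have "\<dots> = - (LINT t:{0..T}|lebesgue. (v t - w t) * \<psi> t)"
    using set_integral_diff(2)[OF int\<psi>[OF int(3)] int\<psi>[OF int(4)]] by (simp add: left_diff_distrib)
  finally show "(LINT t:{0..T}|lebesgue. (f t - h t) * deriv \<psi> t) = - (LINT t:{0..T}|lebesgue. (v t - w t) * \<psi> t)" .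
qed

text \<open>By uniqueness, any weak derivative at hand may replace the chosen one in the norm.\<close>

lemma W1p_norm_eq:
  assumes T: "T > 0" and p: "p \<ge> 1" and wd: "weak_derivative T u v"
  shows "W1p_norm T p u =
    ((LINT t:{0..T}|lebesgue. \<bar>u t\<bar> powr p) + (LINT t:{0..T}|lebesgue. \<bar>v t\<bar> powr p)) powr (1 / p)"
proof -
  define w where "w = (SOME v. weak_derivative T u v)"
  have w: "weak_derivative T u w"
    unfolding w_def using someI[of "weak_derivative T u" v] wd by simp
  have ae: "AE t in lebesgue. t \<in> {0..T} \<longrightarrow> w t = v t"
    by (rule weak_derivative_unique[OF T w wd])
  have meas: "(\<lambda>t. indicator {0..T} t *\<^sub>R \<bar>h t\<bar> powr p) \<in> borel_measurable lebesgue"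
    if "set_integrable lebesgue {0..T} h" for h
  proof -
    have "(\<lambda>t. indicator {0..T} t *\<^sub>R h t) \<in> borel_measurable lebesgue"
      using that by (auto simp: set_integrable_def)
    then have "(\<lambda>t. \<bar>indicator {0..T} t *\<^sub>R h t\<bar> powr p) \<in> borel_measurable lebesgue"
      by simp
    moreover have "(\<lambda>t. \<bar>indicator {0..T} t *\<^sub>R h t\<bar> powr p) = (\<lambda>t. indicator {0..T} t *\<^sub>R \<bar>h t\<bar> powr p)"
      by (auto simp: indicator_def)
    ultimately show ?thesis
      by simp
  qed
  have "(LINT t:{0..T}|lebesgue. \<bar>w t\<bar> powr p) = (LINT t:{0..T}|lebesgue. \<bar>v t\<bar> powr p)"
    unfolding set_lebesgue_integral_def
  proof (rule integral_cong_AE)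
    show "AE t in lebesgue. indicator {0..T} t *\<^sub>R \<bar>w t\<bar> powr p = indicator {0..T} t *\<^sub>R \<bar>v t\<bar> powr p"
      using ae by eventually_elim (auto simp: indicator_def)
  qed (use w wd in \<open>auto intro!: meas[unfolded real_scaleR_def] simp: weak_derivative_def\<close>)
  then show ?thesis
    by (simp add: W1p_norm_def Let_def w_def)
qed

lemma AE_bounded_in_Lp:
  assumes m: "f \<in> borel_measurable lebesgue" and "p \<ge> 1" and b: "AE t in lebesgue. \<bar>f t\<bar> \<le> B"
  shows "f \<in> Lp T p"
proof -
  have ind: "indicat_real {0..T} \<in> borel_measurable lebesgue"
    by (rule measurable_completion) simp
  have "set_borel_measurable lebesgue {0..T} f"
    unfolding set_borel_measurable_def by (rule borel_measurable_scaleR[OF ind m])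
  moreover have "set_integrable lebesgue {0..T} (\<lambda>t. \<bar>f t\<bar> powr p)"
  proof (rule bounded_convergence(1)[where f = "\<lambda>n t. \<bar>f t\<bar> powr p" and B = "B powr p"])
    show "AE t in lebesgue. t \<in> {0..T} \<longrightarrow> \<bar>\<bar>f t\<bar> powr p\<bar> \<le> B powr p" for n
      using b by eventually_elim (use assms(2) in \<open>auto intro!: powr_mono2\<close>)
  qed (use m in auto)
  ultimately show ?thesis
    by (simp add: Lp_def)
qed

lemma tendsto_W1p_bounded_convergence:
  fixes f v :: "nat \<Rightarrow> real \<Rightarrow> real"
  assumes T: "T > 0" and p: "p \<ge> 1"
    and per: "\<And>n. periodic_fun_simple (f n) T" "periodic_fun_simple F T"
    and wd: "\<And>n. weak_derivative T (f n) (v n)"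
    and fm: "\<And>n. f n \<in> borel_measurable lebesgue" and vm: "\<And>n. v n \<in> borel_measurable lebesgue"
    and fb: "\<And>n t. \<bar>f n t\<bar> \<le> K" and vb: "\<And>n t. \<bar>v n t\<bar> \<le> K"
    and fl: "\<And>t. (\<lambda>n. f n t) \<longlonglongrightarrow> F t" and vl: "AE t in lebesgue. convergent (\<lambda>n. v n t)"
  shows "tendsto_W1p T p f F"
proof -
  define V where "V t = lim (\<lambda>n. v n t)" for t
  have vl': "AE t in lebesgue. (\<lambda>n. v n t) \<longlonglongrightarrow> V t"
    using vl by eventually_elim (simp add: V_def convergent_LIMSEQ_iff)
  have Fm: "F \<in> borel_measurable lebesgue"
    by (rule borel_measurable_LIMSEQ_real[OF fl fm])
  have Vm: "V \<in> borel_measurable lebesgue"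
    unfolding V_def by (rule borel_measurable_lim_metric[OF vm])
  have Fb: "\<bar>F t\<bar> \<le> K" for t
    by (rule LIMSEQ_le_const2[OF tendsto_rabs[OF fl]]) (use fb in auto)
  have Vb: "AE t in lebesgue. \<bar>V t\<bar> \<le> K"
    using vl'
  proof eventually_elim
    case (elim t)
    show ?case
      by (rule LIMSEQ_le_const2[OF tendsto_rabs[OF elim]]) (use vb in auto)
  qed
  have wdF: "weak_derivative T F V"
    by (rule weak_derivative_limit[OF wd fm Fm vm Vm fb vb fl vl'])
  have mem_n: "f n \<in> W1p T p" for n
    unfolding W1p_def using per wd[of n] AE_bounded_in_Lp[OF fm p, of n K] AE_bounded_in_Lp[OF vm p, of n K] fb vb
    by auto
  have mem: "F \<in> W1p T p"
    unfolding W1p_def using per wdF AE_bounded_in_Lp[OF Fm p, of K] AE_bounded_in_Lp[OF Vm p Vb] Fb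
    by auto
  have small: "(\<lambda>n. LINT t:{0..T}|lebesgue. \<bar>h n t - H t\<bar> powr p) \<longlonglongrightarrow> 0"
    if hm: "\<And>n. h n \<in> borel_measurable lebesgue" "H \<in> borel_measurable lebesgue"
      and hb: "\<And>n t. \<bar>h n t\<bar> \<le> K" "AE t in lebesgue. \<bar>H t\<bar> \<le> K"
      and hl: "AE t in lebesgue. (\<lambda>n. h n t) \<longlonglongrightarrow> H t" for h :: "nat \<Rightarrow> real \<Rightarrow> real" and H
  proof -
    have "(\<lambda>n. LINT t:{0..T}|lebesgue. \<bar>h n t - H t\<bar> powr p) \<longlonglongrightarrow> (LINT t:{0..T}|lebesgue. 0)"
    proof (rule bounded_convergence(2)[where B = "(2 * K) powr p"])
      show "AE t in lebesgue. t \<in> {0..T} \<longrightarrow> \<bar>\<bar>h n t - H t\<bar> powr p\<bar> \<le> (2 * K) powr p" for n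
        using hb(2)
      proof eventually_elim
        case (elim t)
        have "\<bar>h n t - H t\<bar> \<le> 2 * K"
          using elim hb(1)[of n t] by linarith
        then show ?case
          using p by (auto intro!: powr_mono2)
      qed
      show "AE t in lebesgue. t \<in> {0..T} \<longrightarrow> (\<lambda>n. \<bar>h n t - H t\<bar> powr p) \<longlonglongrightarrow> 0"
        using hl
      proof eventually_elim
        case (elim t)
        have "(\<lambda>n. \<bar>h n t - H t\<bar>) \<longlonglongrightarrow> 0"
          using tendsto_rabs[OF tendsto_diff[OF elim tendsto_const[of "H t"]]] by simp
        then have "(\<lambda>n. \<bar>h n t - H t\<bar> powr p) \<longlonglongrightarrow> 0 powr p"
          by (rule tendsto_powr') (use p in auto)
        then show ?case
          using p by simp
      qed
      show "(\<lambda>t. \<bar>h n t - H t\<bar> powr p) \<in> borel_measurable lebesgue" for n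
      proof -
        note [measurable] = hm
        show ?thesis
          by measurable
      qed
    qed auto
    then show ?thesis
      by (simp add: set_lebesgue_integral_def)
  qed
  have sum0: "(\<lambda>n. (LINT t:{0..T}|lebesgue. \<bar>f n t - F t\<bar> powr p) + (LINT t:{0..T}|lebesgue. \<bar>v n t - V t\<bar> powr p))
      \<longlonglongrightarrow> 0 + 0"
    by (intro tendsto_add small fm Fm vm Vm fb vb Vb vl' AE_I2 Fb fl)
  have nn: "0 \<le> (LINT t:{0..T}|lebesgue. \<bar>h t\<bar> powr p)" for h :: "real \<Rightarrow> real"
    unfolding set_lebesgue_integral_def by (rule integral_nonneg_AE) auto
  have "(\<lambda>n. ((LINT t:{0..T}|lebesgue. \<bar>f n t - F t\<bar> powr p) + (LINT t:{0..T}|lebesgue. \<bar>v n t - V t\<bar> powr p)) powr (1 / p))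
      \<longlonglongrightarrow> (0 + 0) powr (1 / p)"
    by (rule tendsto_powr'[OF sum0 tendsto_const]) (use p nn in \<open>auto intro!: always_eventually add_nonneg_nonneg\<close>)
  then have "(\<lambda>n. W1p_norm T p (\<lambda>t. f n t - F t)) \<longlonglongrightarrow> 0"
    using W1p_norm_eq[OF T p weak_derivative_diff[OF wd wdF]] by simp
  then show ?thesis
    using mem_n mem by (simp add: tendsto_W1p_def)
qed

section \<open>Limit profiles for large parameters\<close>

theorem theorem4p3:
  fixes T \<rho> :: real
    and a g :: "real \<Rightarrow> real"
    and m :: nat
    and \<sigma> \<tau> :: "nat \<Rightarrow> real"
    and u :: "real \<Rightarrow> real \<Rightarrow> real"
  assumes T: "T > 0"
    and a_locint: "locally_integrable a"
    and a_per: "periodic_fun_simple a T"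
    and a_mean: "(LINT t:{0..T}|lebesgue. a t) < 0"
    and m: "m \<ge> 1"
    and I_nondeg: "\<And>i. i \<in> {1..m} \<Longrightarrow> \<sigma> i < \<tau> i"
    and I_disj: "disjoint_family_on (\<lambda>i. periodize T {\<sigma> i..\<tau> i}) {1..m}"
    and a_pos: "\<And>i. i \<in> {1..m} \<Longrightarrow> AE t in lebesgue. t \<in> {\<sigma> i..\<tau> i} \<longrightarrow> a t \<ge> 0"
    and a_pos_nontriv: "\<And>i. i \<in> {1..m} \<Longrightarrow> \<not> (AE t in lebesgue. t \<in> {\<sigma> i..\<tau> i} \<longrightarrow> a t = 0)"
    and a_neg: "AE t in lebesgue. t \<notin> (\<Union>i\<in>{1..m}. periodize T {\<sigma> i..\<tau> i}) \<longrightarrow> a t \<le> 0"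
    and a_nontriv: "\<And>c d. c < d \<Longrightarrow> \<not> (AE t in lebesgue. t \<in> {c<..<d} \<longrightarrow> a t = 0)"
    and g_cont: "continuous_on {0..} g"
    and g_zero: "g 0 = 0"
    and g_pos: "\<And>x. x > 0 \<Longrightarrow> g x > 0"
    and g_limsup: "Limsup (at_right 0) (\<lambda>x. ereal (g x / x)) < \<infinity>"
    and g_infty:
      "((\<lambda>(x, \<omega>). g (\<omega> * x) / g x) \<longlongrightarrow> 1) (at_top \<times>\<^sub>F at 1)
       \<or> (\<exists>\<epsilon>>0. (\<forall>x>1/\<epsilon>. g field_differentiable at x) \<and> continuous_on {1/\<epsilon><..} (deriv g) \<and>
                 ((\<lambda>x. deriv g x / g x) \<longlongrightarrow> 0) at_top)"
    and rho_pos: "\<rho> > 0"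
    and rho_small: "\<And>i. i \<in> {1..m} \<Longrightarrow> \<rho> < (\<tau> i - \<sigma> i) / 4"
    and rho_int: "\<And>i. i \<in> {1..m} \<Longrightarrow> (LINT t:{\<sigma> i + 2*\<rho>..\<tau> i - 2*\<rho>}|lebesgue. a t) > 0"
    and u_sol: "\<And>lam. lam > lambda_star m \<sigma> \<tau> a g \<rho> \<Longrightarrow> positive_periodic_solution T lam a g (u lam)"
    and u_large: "\<And>lam. lam > lambda_star m \<sigma> \<tau> a g \<rho> \<Longrightarrow> sup_norm (u lam) > \<rho>"
  shows "\<exists>ulim :: real \<Rightarrow> real.
           (\<exists>t. ulim t \<noteq> 0) \<and>
           (\<exists>L. L-lipschitz_on UNIV ulim) \<and>
           periodic_fun_simple ulim T \<and>
           (AE t in lebesgue. ulim field_differentiable at t \<and> deriv ulim t \<in> {-1, 0, 1}) \<and>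
           (\<exists>\<nu> :: nat \<Rightarrow> real.
              (\<forall>n. \<nu> n > lambda_star m \<sigma> \<tau> a g \<rho>) \<and>
              filterlim \<nu> at_top sequentially \<and>
              (\<forall>p\<ge>1. tendsto_W1p T p (\<lambda>n. u (\<nu> n)) ulim))"
proof -
  define \<Lambda> where "\<Lambda> = lambda_star m \<sigma> \<tau> a g \<rho>"
  define lam0 where "lam0 n = max (\<Lambda> + 1) (real n + 1)" for n
  have lam0: "lam0 n > \<Lambda>" "lam0 n > 0" "lam0 n \<ge> real n" for n
    by (auto simp: lam0_def)
  define f where "f n = u (lam0 n)" for n
  have pps: "positive_periodic_solution T (lam0 n) a g (f n)" for n
    using u_sol lam0(1) by (simp add: f_def \<Lambda>_def)
  then have sol: "is_solution (lam0 n) a g (f n)" and per: "periodic_fun_simple (f n) T"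
    and pos: "f n t > 0" for n t
    by (auto simp: positive_periodic_solution_def)
  obtain K where K: "\<And>lam u t. lam > 0 \<Longrightarrow> positive_periodic_solution T lam a g u \<Longrightarrow> u t \<le> K"
    using positive_periodic_solutions_bounded[OF T a_locint a_mean g_cont g_pos g_infty] by blast
  have fK: "f n t \<le> K" for n t
    by (rule K[OF lam0(2) pps])
  have g_nonneg: "g x \<ge> 0" if "x \<ge> 0" for x
    using g_pos[of x] g_zero that by (cases "x = 0") (auto simp: less_imp_le)
  obtain g0 k where k: "strict_mono (k :: nat \<Rightarrow> nat)"
    and g0: "\<And>e. 0 < e \<Longrightarrow> \<exists>N. \<forall>n x. n \<ge> N \<and> x \<in> {0..T} \<longrightarrow> norm (f (k n) x - g0 x) < e"
  proof (rule Arzela_Ascoli[of "{0..T}" f K])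
    show "norm (f n x) \<le> K" for n x
      using pos[of n x] fK[of n x] by simp
    show "\<exists>d. 0 < d \<and> (\<forall>n y. y \<in> {0..T} \<and> norm (x - y) < d \<longrightarrow> norm (f n x - f n y) < e)"
      if "0 < e" for x e
      using that solution_nonexpansive[OF sol] by (intro exI[of _ e]) (auto intro: le_less_trans)
  qed auto
  \<comment> \<open>Arzela--Ascoli gives convergence on one period; \<open>U\<close> is its periodic extension.\<close>
  define U where "U t = g0 (T * frac (t / T))" for t
  define w where "w n = f (k n)" for n
  define lam where "lam n = lam0 (k n)" for n
  have wsol: "is_solution (lam n) a g (w n)" and wper: "periodic_fun_simple (w n) T"
    and wpos: "w n t > 0" and wK: "w n t \<le> K" and lam_pos: "lam n > 0" for n t
    using sol per pos fK lam0(2) by (auto simp: w_def lam_def)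
  have unif: "uniform_limit UNIV w U sequentially"
  proof (rule uniform_limitI)
    fix e :: real
    assume "e > 0"
    from g0[OF this] obtain N where N: "\<And>n x. n \<ge> N \<Longrightarrow> x \<in> {0..T} \<Longrightarrow> norm (f (k n) x - g0 x) < e"
      by blast
    have "dist (w n t) (U t) < e" if "n \<ge> N" for n t
      using N[OF that periodic_fun_simple_reduce(2)[OF per T, of t]] periodic_fun_simple_reduce(1)[OF per T, of "k n" t]
      by (simp add: w_def U_def dist_norm)
    then show "\<forall>\<^sub>F n in sequentially. \<forall>t\<in>UNIV. dist (w n t) (U t) < e"
      by (auto simp: eventually_sequentially)
  qed
  have ptlim: "(\<lambda>n. w n t) \<longlonglongrightarrow> U t" for t
    by (rule tendsto_uniform_limitI[OF unif]) simp
  have lam_lim: "filterlim lam at_top sequentially"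
  proof (rule filterlim_at_top_mono[OF filterlim_real_sequentially])
    have "real n \<le> lam n" for n
      using lam0(3)[of "k n"] seq_suble[OF k, of n] by (simp add: lam_def)
    then show "\<forall>\<^sub>F n in sequentially. real n \<le> lam n"
      by simp
  qed
  have Uper: "periodic_fun_simple U T"
  proof
    fix t
    have "(\<lambda>n. w n (t + T)) = (\<lambda>n. w n t)"
      using periodic_fun_simple.plus_period[OF wper] by simp
    then show "U (t + T) = U t"
      using ptlim[of "t + T"] ptlim[of t] LIMSEQ_unique by simp
  qed
  have Ulip: "1-lipschitz_on UNIV U"
  proof (rule lipschitz_onI)
    fix s t
    have "\<bar>U s - U t\<bar> \<le> \<bar>s - t\<bar>"
      by (rule LIMSEQ_le_const2[OF tendsto_rabs[OF tendsto_diff[OF ptlim ptlim]]])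
         (use solution_nonexpansive[OF wsol] in auto)
    then show "dist (U s) (U t) \<le> 1 * dist s t"
      by (simp add: dist_real_def)
  qed auto
  have Unz: "\<exists>t. U t \<noteq> 0"
  proof (rule ccontr)
    assume "\<not> (\<exists>t. U t \<noteq> 0)"
    then have "\<forall>\<^sub>F n in sequentially. \<forall>t. \<bar>w n t\<bar> < \<rho>"
      using uniform_limitD[OF unif rho_pos] by (simp add: dist_real_def)
    then obtain n where n: "\<And>t. \<bar>w n t\<bar> < \<rho>"
      by (auto simp: eventually_sequentially)
    have "sup_norm (w n) \<le> \<rho>"
      unfolding sup_norm_def by (rule cSUP_least) (use n in \<open>auto simp: less_imp_le\<close>)
    moreover have "sup_norm (w n) > \<rho>"
      using u_large lam0(1) by (simp add: w_def f_def \<Lambda>_def)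
    ultimately show False
      by simp
  qed
  \<comment> \<open>\<open>E\<close> collects the translates of the endpoints of the intervals of positivity; all other points lie in an interval on which \<open>a\<close> has one sign.\<close>
  define good where "good t \<longleftrightarrow>
    (\<exists>L\<in>{-1, 0, 1}. (U has_field_derivative L) (at t) \<and> (\<lambda>n. deriv (w n) t) \<longlonglongrightarrow> L)" for t
  define E where "E = (\<Union>i\<in>{1..m}. periodize T {\<sigma> i, \<tau> i})"
  have cE: "countable E"
    unfolding E_def by (intro countable_UN countable_periodize) auto
  have cG: "countable ({t. \<not> good t} - E)"
  proof (rule countable_if_locally_countable)
    fix t
    assume "t \<in> {t. \<not> good t} - E"
    then obtain p q s where pq: "p < t" "t < q" and s: "s \<in> {1, -1}"
      and sign: "AE r in lebesgue. r \<in> {p<..<q} \<longrightarrow> s * a r \<ge> 0"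
      using weight_locally_signed[OF a_per a_pos a_neg, of t] unfolding E_def by blast
    obtain C where C: "countable C" "\<And>t. t \<in> {p<..<q} - C \<Longrightarrow> good t"
      using limit_derivative_on_signed_interval[OF a_locint a_nontriv g_cont g_nonneg g_pos s sign
          lam_pos lam_lim wsol wpos wK unif]
      unfolding good_def by blast
    have "countable (({t. \<not> good t} - E) \<inter> {p<..<q})"
      by (rule countable_subset[OF _ C(1)]) (use C(2) in blast)
    then show "\<exists>p q. p < t \<and> t < q \<and> countable (({t. \<not> good t} - E) \<inter> {p<..<q})"
      using pq by blast
  qed
  have "countable {t. \<not> good t}"
    by (rule countable_subset[OF _ countable_Un[OF cE cG]]) auto
  then have good: "AE t in lebesgue. good t"
    by (intro AE_I'[of "{t. \<not> good t}"] null_sets_completionI countable_imp_null_set_lborel) auto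
  have limit_deriv: "AE t in lebesgue. U field_differentiable at t \<and> deriv U t \<in> {-1, 0, 1}"
    using good
  proof eventually_elim
    case (elim t)
    then obtain L where "L \<in> {-1, 0, 1}" "(U has_field_derivative L) (at t)"
      by (auto simp: good_def)
    then show ?case
      by (metis DERIV_imp_deriv field_differentiable_def)
  qed
  have "tendsto_W1p T p w U" if "p \<ge> 1" for p
  proof (rule tendsto_W1p_bounded_convergence[where v = "\<lambda>n. deriv (w n)" and K = "max K 1", OF T that wper Uper])
    have der: "(w n has_field_derivative deriv (w n) t) (at t)" for n t
      by (rule solution_has_field_derivative[OF wsol])
    have dcont: "continuous_on UNIV (deriv (w n))" for n
      using wsol[of n] by (simp add: is_solution_def)
    show "weak_derivative T (w n) (deriv (w n))" for n
      by (rule weak_derivative_of_periodic_C1[OF T wper der dcont])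
    show "w n \<in> borel_measurable lebesgue" "deriv (w n) \<in> borel_measurable lebesgue" for n
      using borel_measurable_continuous_onI[OF solution_continuous_on[OF wsol]] borel_measurable_continuous_onI[OF dcont]
      by (auto intro: measurable_completion)
    show "\<bar>w n t\<bar> \<le> max K 1" for n t
      using wpos[of n t] wK[of n t] by simp
    show "\<bar>deriv (w n) t\<bar> \<le> max K 1" for n t
    proof -
      have "\<bar>deriv (w n) t\<bar> < 1"
        using wsol[of n] by (simp add: is_solution_def)
      then show ?thesis
        by simp
    qed
    show "AE t in lebesgue. convergent (\<lambda>n. deriv (w n) t)"
      using good by eventually_elim (auto simp: good_def convergent_def)
  qed (rule ptlim)
  then have "\<forall>p\<ge>1. tendsto_W1p T p (\<lambda>n. u (lam n)) U"
    by (simp add: lam_def w_def[abs_def] f_def)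
  moreover have "\<forall>n. lam n > lambda_star m \<sigma> \<tau> a g \<rho>"
    using lam0(1) by (simp add: lam_def \<Lambda>_def)
  ultimately show ?thesis
    using Unz Ulip Uper limit_deriv lam_lim by blast
qed

end
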